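(* Let $\mathcal I$ be an ideal of $\Phi^+$. (1) Let $\mathcal I_{min}$ be the set of minimal elements of $\mathcal I$. Then there exist $J \subset \Pi$ and $y \in W$ such that $y(\mathcal I_{min}) = J$. (2) Suppose $\mathcal I$ is strictly positive and let $\mathcal I_{max}$ be the set of maximal elements of $\Phi^+ - \mathcal I$. Then there exist $J \subset \Pi$ and $y \in W$ such that $y(\mathcal I_{max}) = J$.
   Context: Let $G$ be a connected simple algebraic group over $\mathbf C$, $B$ a Borel subgroup, $T \subset B$ a maximal torus, $\Phi$ the (irreducible) root system of $(G,T)$, $W$ the Weyl group, and $\Pi \subset \Phi^+ \subset \Phi$ the simple and positive roots determined by $B$. For $\alpha,\beta\in\Phi$ write $\alpha \prec \beta$ if $\beta-\alpha$ is a sum of positive roots; minimal and maximal elements are taken with respect to $\prec$. An ideal of $\Phi^+$ is a subset $\mathcal I \subset \Phi^+$ such that if $\alpha \in \mathcal I$, $\beta \in \Phi^+$ and $\alpha+\beta \in \Phi^+$, then $\alpha+\beta \in \mathcal I$. An ideal $\mathcal I$ is strictly positive if $\mathcal I \cap \Pi = \emptyset$. *)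

theory Defs
  imports "HOL-Analysis.Analysis" "HOL-Algebra.Generated_Groups" "HOL-Algebra.Bij"
begin

text \<open>
  The pair \<open>(G, T)\<close> enters only through its root system, viewed in the Euclidean space
  of real characters of \<open>T\<close> with a Weyl-invariant inner product. The root systems of connected
  simple algebraic groups over the complex numbers are exactly the irreducible reduced
  crystallographic ones, and the Borel subgroups containing \<open>T\<close> correspond to the bases (sets of simple roots)
  \<open>\<Delta>\<close> of \<open>\<Phi>\<close>.
\<close>

definition reflection :: "'a::real_inner \<Rightarrow> 'a \<Rightarrow> 'a" where
  "reflection \<alpha> x = x - (2 * (x \<bullet> \<alpha>) / (\<alpha> \<bullet> \<alpha>)) *\<^sub>R \<alpha>"

definition root_system :: "'a::euclidean_space set \<Rightarrow> bool" where
  "root_system \<Phi> \<longleftrightarrow>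
     finite \<Phi> \<and> 0 \<notin> \<Phi> \<and> span \<Phi> = UNIV \<and>
     (\<forall>\<alpha>\<in>\<Phi>. \<forall>c::real. c *\<^sub>R \<alpha> \<in> \<Phi> \<longrightarrow> c = 1 \<or> c = -1) \<and>
     (\<forall>\<alpha>\<in>\<Phi>. \<forall>\<beta>\<in>\<Phi>. reflection \<alpha> \<beta> \<in> \<Phi>) \<and>
     (\<forall>\<alpha>\<in>\<Phi>. \<forall>\<beta>\<in>\<Phi>. 2 * (\<beta> \<bullet> \<alpha>) / (\<alpha> \<bullet> \<alpha>) \<in> \<int>)"

definition irreducible_root_system :: "'a::euclidean_space set \<Rightarrow> bool" where
  "irreducible_root_system \<Phi> \<longleftrightarrow>
     root_system \<Phi> \<and> \<Phi> \<noteq> {} \<and>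
     \<not> (\<exists>A B. A \<noteq> {} \<and> B \<noteq> {} \<and> A \<union> B = \<Phi> \<and> A \<inter> B = {} \<and>
          (\<forall>\<alpha>\<in>A. \<forall>\<beta>\<in>B. \<alpha> \<bullet> \<beta> = 0))"

definition root_base :: "'a::euclidean_space set \<Rightarrow> 'a set \<Rightarrow> bool" where
  "root_base \<Phi> \<Delta> \<longleftrightarrow>
     \<Delta> \<subseteq> \<Phi> \<and> independent \<Delta> \<and>
     (\<forall>\<beta>\<in>\<Phi>. \<exists>c::'a \<Rightarrow> int. \<beta> = (\<Sum>\<alpha>\<in>\<Delta>. of_int (c \<alpha>) *\<^sub>R \<alpha>) \<and>
        ((\<forall>\<alpha>\<in>\<Delta>. c \<alpha> \<ge> 0) \<or> (\<forall>\<alpha>\<in>\<Delta>. c \<alpha> \<le> 0)))"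

definition positive_roots :: "'a::euclidean_space set \<Rightarrow> 'a set \<Rightarrow> 'a set" where
  "positive_roots \<Phi> \<Delta> =
     {\<beta> \<in> \<Phi>. \<exists>c::'a \<Rightarrow> nat. \<beta> = (\<Sum>\<alpha>\<in>\<Delta>. of_nat (c \<alpha>) *\<^sub>R \<alpha>)}"

definition weyl_group :: "'a::euclidean_space set \<Rightarrow> ('a \<Rightarrow> 'a) set" where
  "weyl_group \<Phi> = generate (BijGroup UNIV) (reflection ` \<Phi>)"

text \<open>
  Below, \<open>P\<close> stands for the set of positive roots. The empty sum is allowed in
  \<open>root_prec\<close>, which is thus reflexive; this does not affect minimal and maximal elements,
  where equality is excluded.
\<close>

definition root_prec :: "'a::euclidean_space set \<Rightarrow> 'a \<Rightarrow> 'a \<Rightarrow> bool" where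
  "root_prec P \<alpha> \<beta> \<longleftrightarrow> (\<exists>xs. set xs \<subseteq> P \<and> \<beta> - \<alpha> = sum_list xs)"

definition minimal_roots :: "'a::euclidean_space set \<Rightarrow> 'a set \<Rightarrow> 'a set" where
  "minimal_roots P S = {\<alpha> \<in> S. \<not> (\<exists>\<beta>\<in>S. \<beta> \<noteq> \<alpha> \<and> root_prec P \<beta> \<alpha>)}"

definition maximal_roots :: "'a::euclidean_space set \<Rightarrow> 'a set \<Rightarrow> 'a set" where
  "maximal_roots P S = {\<alpha> \<in> S. \<not> (\<exists>\<beta>\<in>S. \<beta> \<noteq> \<alpha> \<and> root_prec P \<alpha> \<beta>)}"

definition root_ideal :: "'a::euclidean_space set \<Rightarrow> 'a set \<Rightarrow> bool" where
  "root_ideal P I \<longleftrightarrow>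
     I \<subseteq> P \<and> (\<forall>\<alpha>\<in>I. \<forall>\<beta>\<in>P. \<alpha> + \<beta> \<in> P \<longrightarrow> \<alpha> + \<beta> \<in> I)"

definition strictly_positive :: "'a set \<Rightarrow> 'a set \<Rightarrow> bool" where
  "strictly_positive \<Delta> I \<longleftrightarrow> I \<inter> \<Delta> = {}"

end

theory Submission
  imports Defs
begin

text \<open>
Only one property of the two sets of roots matters: each is an antichain of positive roots for
\<open>\<prec>\<close>. The claim is that every such antichain \<open>A\<close> is carried by the Weyl group
into the simple roots.

Let \<open>U\<close> be the span of \<open>A\<close>. Some Weyl group element \<open>y\<close> makes a generic vector
orthogonal to \<open>U\<close>, perturbed into the dominant chamber, dominant; then \<open>y\<close> keeps the
positive roots in \<open>U\<close> positive, and the simple roots in \<open>y U\<close> form a base of the roots in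
\<open>y U\<close> (\<open>ex_weyl_parabolic\<close>). So \<open>y A\<close> is an antichain that spans, and it
remains to prove that an antichain \<open>A\<close> spanning the root system is the base itself
(\<open>spanning_antichain_eq_base\<close>).

Distinct elements of \<open>A\<close> do not differ by a root, so they are pairwise obtuse; lying in an open
half space they are independent, and there is a point \<open>x\<close> with inner product \<open>1\<close> with
each of them. For a positive root \<open>\<gamma>\<close> let \<open>k(\<gamma>)\<close> be the largest number of
elements of \<open>A\<close> in a decomposition of \<open>\<gamma>\<close> into positive roots, and put
\<open>k(-\<gamma>) = -k(\<gamma>) - 1\<close>. This is the address of an alcove: \<open>k\<close> is superadditive
on roots, and the antichain property makes it grow by exactly \<open>1\<close> when an element of \<open>A\<close>
is added; geometrically, the hyperplanes where \<open>\<beta> \<in> A\<close> takes the value \<open>1\<close> are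
walls of the alcove and \<open>x\<close> is a vertex of it. The set \<open>Q\<close> of roots with
\<open>k(\<gamma>) \<ge> (x, \<gamma>)\<close> is then closed under addition, and the reflection in
\<open>\<beta> \<in> A\<close> permutes \<open>Q - {\<beta>}\<close>. As for half the sum of the positive coroots, this
forces the sum of the coroots of \<open>Q\<close> to act on the roots as \<open>2 x\<close>. Two consequences follow: \<open>(x, \<gamma>)\<close>
is a half-integer for all roots, and it is positive for all positive roots
(\<open>dual_point_pos_half_integral\<close>).

Hence \<open>(x, \<alpha>) \<ge> 1/2\<close> on simple roots, while \<open>(x, \<beta>) = 1\<close> for
\<open>\<beta> \<in> A\<close>: each \<open>\<beta>\<close> is simple or the sum of two simple roots, which are then joined
in the Dynkin diagram and lie outside \<open>A\<close>. A Dynkin diagram has fewer edges than vertices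
(\<open>card_edges_less\<close>), so if some simple root were missing from \<open>A\<close>, then \<open>A\<close> would
have fewer elements than the base, contradicting that it spans.
\<close>

section \<open>Finite crystallographic root sets\<close>

text \<open>
The roots are not required to span the space, so that the roots inside a subspace qualify as well.
\<close>

locale root_set =
  fixes \<Phi> :: "'a::euclidean_space set"
  assumes finite_roots: "finite \<Phi>"
    and zero_notin: "0 \<notin> \<Phi>"
    and reduced: "\<And>\<alpha> c. \<alpha> \<in> \<Phi> \<Longrightarrow> c *\<^sub>R \<alpha> \<in> \<Phi> \<Longrightarrow> c = 1 \<or> c = -1"
    and reflection_mem: "\<And>\<alpha> \<beta>. \<alpha> \<in> \<Phi> \<Longrightarrow> \<beta> \<in> \<Phi> \<Longrightarrow> reflection \<alpha> \<beta> \<in> \<Phi>"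
    and cartan_Ints: "\<And>\<alpha> \<beta>. \<alpha> \<in> \<Phi> \<Longrightarrow> \<beta> \<in> \<Phi> \<Longrightarrow> 2 * (\<beta> \<bullet> \<alpha>) / (\<alpha> \<bullet> \<alpha>) \<in> \<int>"

lemma reflection_inner: "reflection \<alpha> x \<bullet> y = x \<bullet> y - (2 * (x \<bullet> \<alpha>) / (\<alpha> \<bullet> \<alpha>)) * (\<alpha> \<bullet> y)"
  by (simp add: reflection_def inner_diff_left)

lemma linear_reflection: "linear (reflection \<alpha>)"
  by (rule linearI) (auto simp: reflection_def inner_add_left algebra_simps add_divide_distrib)

lemma reflection_inner_self: "reflection \<alpha> x \<bullet> \<alpha> = - (x \<bullet> \<alpha>)"
  by (cases "\<alpha> = 0") (auto simp: reflection_inner)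

lemma reflection_reflection [simp]: "reflection \<alpha> (reflection \<alpha> x) = x"
  using reflection_inner_self[of \<alpha> x] unfolding reflection_def[of \<alpha> "reflection \<alpha> x"]
  by (simp add: reflection_def)

lemma reflection_inner_reflection: "reflection \<alpha> x \<bullet> reflection \<alpha> y = x \<bullet> y"
proof -
  have "reflection \<alpha> x \<bullet> reflection \<alpha> y
      = x \<bullet> reflection \<alpha> y - (2 * (x \<bullet> \<alpha>) / (\<alpha> \<bullet> \<alpha>)) * (reflection \<alpha> y \<bullet> \<alpha>)"
    by (simp add: reflection_inner inner_commute)
  also have "x \<bullet> reflection \<alpha> y = x \<bullet> y - (2 * (x \<bullet> \<alpha>) / (\<alpha> \<bullet> \<alpha>)) * (y \<bullet> \<alpha>)"
    by (simp add: reflection_def inner_diff_right inner_commute)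
  finally have "reflection \<alpha> x \<bullet> reflection \<alpha> y = x \<bullet> y - (2 * (x \<bullet> \<alpha>) / (\<alpha> \<bullet> \<alpha>)) * (y \<bullet> \<alpha>)
      - (2 * (x \<bullet> \<alpha>) / (\<alpha> \<bullet> \<alpha>)) * (reflection \<alpha> y \<bullet> \<alpha>)" .
  also have "\<dots> = x \<bullet> y"
    by (simp add: reflection_inner_self)
  finally show ?thesis .
qed

lemma reflection_uminus [simp]: "reflection (- \<alpha>) = reflection \<alpha>"
  by (rule ext) (simp add: reflection_def)

context root_set
begin

lemma inner_self_pos: "\<alpha> \<in> \<Phi> \<Longrightarrow> 0 < \<alpha> \<bullet> \<alpha>"
  using zero_notin by auto

lemma uminus_mem: assumes "\<alpha> \<in> \<Phi>" shows "- \<alpha> \<in> \<Phi>"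
proof -
  have "reflection \<alpha> \<alpha> = - \<alpha>"
    using inner_self_pos[OF assms] by (simp add: reflection_def scaleR_2)
  then show ?thesis using reflection_mem[OF assms assms] by simp
qed

lemma diff_mem:
  assumes a: "\<alpha> \<in> \<Phi>" and b: "\<beta> \<in> \<Phi>" and pos: "0 < \<alpha> \<bullet> \<beta>" and ne: "\<alpha> \<noteq> \<beta>"
  shows "\<alpha> - \<beta> \<in> \<Phi>"
proof -
  define m where "m = 2 * (\<alpha> \<bullet> \<beta>) / (\<beta> \<bullet> \<beta>)"
  define n where "n = 2 * (\<beta> \<bullet> \<alpha>) / (\<alpha> \<bullet> \<alpha>)"
  have pa: "0 < \<alpha> \<bullet> \<alpha>" and pb: "0 < \<beta> \<bullet> \<beta>" using a b inner_self_pos by auto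
  have "m \<in> \<int>" "n \<in> \<int>" using cartan_Ints a b by (auto simp: m_def n_def)
  then obtain i j where ij: "m = of_int i" "n = of_int j" by (auto elim!: Ints_cases)
  have "m > 0" "n > 0" using pos pa pb by (auto simp: m_def n_def inner_commute)
  then have ij1: "i \<ge> 1" "j \<ge> 1" using ij by auto
  have mn: "m * n = 4 * (\<alpha> \<bullet> \<beta>)\<^sup>2 / ((\<alpha> \<bullet> \<alpha>) * (\<beta> \<bullet> \<beta>))"
    by (simp add: m_def n_def inner_commute power2_eq_square)
  \<comment> \<open>Proportional roots are excluded by reducedness, so Cauchy-Schwarz is strict.\<close>
  have strict: "(\<alpha> \<bullet> \<beta>)\<^sup>2 < (\<alpha> \<bullet> \<alpha>) * (\<beta> \<bullet> \<beta>)"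
  proof (rule ccontr)
    assume "\<not> ?thesis"
    then have eq: "(\<alpha> \<bullet> \<beta>)\<^sup>2 = (\<alpha> \<bullet> \<alpha>) * (\<beta> \<bullet> \<beta>)"
      using Cauchy_Schwarz_ineq[of \<alpha> \<beta>] by simp
    define d where "d = \<alpha> - ((\<alpha> \<bullet> \<beta>) / (\<beta> \<bullet> \<beta>)) *\<^sub>R \<beta>"
    have "d \<bullet> d = \<alpha> \<bullet> \<alpha> - (\<alpha> \<bullet> \<beta>)\<^sup>2 / (\<beta> \<bullet> \<beta>)"
      using pb by (simp add: d_def inner_diff_left inner_diff_right inner_commute field_simps power2_eq_square)
    also have "\<dots> = 0" using eq pb by simp
    finally have al: "\<alpha> = ((\<alpha> \<bullet> \<beta>) / (\<beta> \<bullet> \<beta>)) *\<^sub>R \<beta>" by (simp add: d_def)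
    then have "(\<alpha> \<bullet> \<beta>) / (\<beta> \<bullet> \<beta>) = 1 \<or> (\<alpha> \<bullet> \<beta>) / (\<beta> \<bullet> \<beta>) = -1"
      using reduced[OF b, of "(\<alpha> \<bullet> \<beta>) / (\<beta> \<bullet> \<beta>)"] a by simp
    moreover have "(\<alpha> \<bullet> \<beta>) / (\<beta> \<bullet> \<beta>) > 0" using pos pb by simp
    ultimately have "(\<alpha> \<bullet> \<beta>) / (\<beta> \<bullet> \<beta>) = 1" by linarith
    then have "\<alpha> = 1 *\<^sub>R \<beta>" using al by metis
    then show False using ne by simp
  qed
  have "m * n < 4" unfolding mn using strict pa pb by (simp add: field_simps)
  then have "of_int (i * j) < (of_int 4 :: real)" using ij by simp
  then have "i * j < 4" by (simp only: of_int_less_iff)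
  then have "i = 1 \<or> j = 1"
  proof -
    have "\<not> (i \<ge> 2 \<and> j \<ge> 2)" using mult_mono[of 2 i 2 j] \<open>i * j < 4\<close> by auto
    then show ?thesis using ij1 by linarith
  qed
  then show ?thesis
  proof
    assume "i = 1"
    then have "2 * (\<alpha> \<bullet> \<beta>) / (\<beta> \<bullet> \<beta>) = 1" using ij(1) \<open>i = 1\<close> unfolding m_def by (metis of_int_1)
    then have "reflection \<beta> \<alpha> = \<alpha> - \<beta>" by (simp only: reflection_def scaleR_one)
    then show ?thesis using reflection_mem[OF b a] by simp
  next
    assume "j = 1"
    then have "2 * (\<beta> \<bullet> \<alpha>) / (\<alpha> \<bullet> \<alpha>) = 1" using ij(2) \<open>j = 1\<close> unfolding n_def by (metis of_int_1)
    then have "reflection \<alpha> \<beta> = \<beta> - \<alpha>" by (simp only: reflection_def scaleR_one)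
    then have "\<beta> - \<alpha> \<in> \<Phi>" using reflection_mem[OF a b] by simp
    then show ?thesis using uminus_mem by fastforce
  qed
qed

lemma add_mem:
  assumes "\<alpha> \<in> \<Phi>" "\<beta> \<in> \<Phi>" "\<alpha> \<bullet> \<beta> < 0" "\<alpha> \<noteq> - \<beta>"
  shows "\<alpha> + \<beta> \<in> \<Phi>"
  using diff_mem[of \<alpha> "- \<beta>"] assms uminus_mem by auto

text \<open>
Root strings are unbroken: the reflection adds \<open>\<gamma>\<close> repeatedly, and each partial sum is a
root as long as the inner product with \<open>\<gamma>\<close> is negative. The remaining partial sums are reached
from the other end of the string by induction.
\<close>

lemma reflection_mem_of_add_closed:
  assumes g: "\<gamma> \<in> \<Phi>" and Q: "Q \<subseteq> \<Phi>" "- \<gamma> \<notin> Q"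
    and cl: "\<And>\<delta>. \<delta> \<in> Q \<Longrightarrow> \<delta> + \<gamma> \<in> \<Phi> \<Longrightarrow> \<delta> + \<gamma> \<in> Q"
    and d: "\<delta> \<in> Q" "\<delta> \<bullet> \<gamma> \<le> 0"
  shows "reflection \<gamma> \<delta> \<in> Q"
proof -
  have pg: "\<gamma> \<bullet> \<gamma> > 0" using g inner_self_pos by auto
  have main: "\<delta> + real n *\<^sub>R \<gamma> \<in> Q"
    if "\<delta> \<in> Q" "2 * (\<delta> \<bullet> \<gamma>) / (\<gamma> \<bullet> \<gamma>) = - real n" for n \<delta>
    using that
  proof (induction n arbitrary: \<delta> rule: less_induct)
    case (less n)
    show ?case
    proof (cases "n = 0")
      case True then show ?thesis using less by simp
    next
      case False
      have "2 * (\<delta> \<bullet> \<gamma>) / (\<gamma> \<bullet> \<gamma>) < 0" using less.prems(2) False by simp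
      then have neg: "\<delta> \<bullet> \<gamma> < 0" using pg by (simp add: divide_less_0_iff)
      have dF: "\<delta> \<in> \<Phi>" using less Q by auto
      have "\<delta> + \<gamma> \<in> \<Phi>" using add_mem[OF dF g neg] less.prems Q by auto
      then have dg: "\<delta> + \<gamma> \<in> Q" using cl less.prems by auto
      show ?thesis
      proof (cases "n = 1")
        case True then show ?thesis using dg by simp
      next
        case n1: False
        then have n2: "n \<ge> 2" using False by auto
        have "2 * ((\<delta> + \<gamma>) \<bullet> \<gamma>) / (\<gamma> \<bullet> \<gamma>) = - real (n - 2)"
          using less.prems(2) pg n2 by (simp add: inner_add_left field_simps of_nat_diff)
        then have "\<delta> + \<gamma> + real (n - 2) *\<^sub>R \<gamma> \<in> Q" using less.IH[of "n - 2" "\<delta> + \<gamma>"] n2 dg by auto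
        then have "\<delta> + real (n - 1) *\<^sub>R \<gamma> \<in> Q"
          using n2 by (simp add: of_nat_diff algebra_simps scaleR_2)
        moreover have "(\<delta> + real (n - 1) *\<^sub>R \<gamma>) + \<gamma> = reflection \<gamma> \<delta>"
          using less.prems(2) n2 by (simp add: reflection_def of_nat_diff algebra_simps)
        moreover have "reflection \<gamma> \<delta> \<in> \<Phi>" using reflection_mem g dF by auto
        moreover have "reflection \<gamma> \<delta> = \<delta> + real n *\<^sub>R \<gamma>"
          using less.prems(2) by (simp add: reflection_def)
        ultimately show ?thesis using cl by metis
      qed
    qed
  qed
  have "2 * (\<delta> \<bullet> \<gamma>) / (\<gamma> \<bullet> \<gamma>) \<in> \<int>" using cartan_Ints g d Q by auto
  then obtain i where i: "2 * (\<delta> \<bullet> \<gamma>) / (\<gamma> \<bullet> \<gamma>) = of_int i" by (auto elim!: Ints_cases)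
  have "2 * (\<delta> \<bullet> \<gamma>) / (\<gamma> \<bullet> \<gamma>) \<le> 0" using d pg by (simp add: divide_nonpos_pos)
  then have "i \<le> 0" using i by simp
  then have e: "2 * (\<delta> \<bullet> \<gamma>) / (\<gamma> \<bullet> \<gamma>) = - real (nat (- i))" using i by simp
  show ?thesis using main[OF d(1) e] e by (simp add: reflection_def)
qed

end

definition coroot_sum :: "'a::euclidean_space set \<Rightarrow> 'a" where
  "coroot_sum Q = (\<Sum>\<delta>\<in>Q. (2 / (\<delta> \<bullet> \<delta>)) *\<^sub>R \<delta>)"

lemma coroot_sum_inner: "coroot_sum Q \<bullet> \<gamma> = (\<Sum>\<delta>\<in>Q. 2 * (\<delta> \<bullet> \<gamma>) / (\<delta> \<bullet> \<delta>))"
  by (simp add: coroot_sum_def inner_sum_left)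

lemma reflection_coroot_inner:
  "2 * (reflection \<gamma> \<delta> \<bullet> \<gamma>) / (reflection \<gamma> \<delta> \<bullet> reflection \<gamma> \<delta>) = - (2 * (\<delta> \<bullet> \<gamma>) / (\<delta> \<bullet> \<delta>))"
  by (simp add: reflection_inner_self reflection_inner_reflection)

context root_set
begin

lemma coroot_sum_inner_Ints:
  assumes "Q \<subseteq> \<Phi>" "\<gamma> \<in> \<Phi>" shows "coroot_sum Q \<bullet> \<gamma> \<in> \<int>"
  unfolding coroot_sum_inner using assms cartan_Ints
  by (intro Ints_sum) (metis inner_commute subsetD)

text \<open>
For \<open>Q\<close> a set of positive roots this is the statement that the sum of the positive coroots is
regular dominant. A term \<open>\<delta>\<close> with negative inner product is cancelled by its reflection in
\<open>\<gamma>\<close>, which is in \<open>Q\<close> because \<open>Q\<close> is closed under addition; the term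
\<open>\<gamma>\<close> itself contributes \<open>2\<close> and is never used up in this way.
\<close>

lemma coroot_sum_inner_ge_2:
  assumes Q: "Q \<subseteq> \<Phi>"
    and anti: "\<And>\<gamma>. \<gamma> \<in> Q \<Longrightarrow> - \<gamma> \<notin> Q"
    and cl: "\<And>\<gamma> \<delta>. \<gamma> \<in> Q \<Longrightarrow> \<delta> \<in> Q \<Longrightarrow> \<gamma> + \<delta> \<in> \<Phi> \<Longrightarrow> \<gamma> + \<delta> \<in> Q"
    and g: "\<gamma> \<in> Q"
  shows "2 \<le> coroot_sum Q \<bullet> \<gamma>"
proof -
  define t where "t \<delta> = 2 * (\<delta> \<bullet> \<gamma>) / (\<delta> \<bullet> \<delta>)" for \<delta>
  define N where "N = {\<delta> \<in> Q. \<delta> \<bullet> \<gamma> < 0}"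
  let ?s = "reflection \<gamma>"
  have gF: "\<gamma> \<in> \<Phi>" using g Q by auto
  have finQ: "finite Q" using Q finite_roots finite_subset by auto
  have sN: "?s ` N \<subseteq> Q"
  proof
    fix \<epsilon> assume "\<epsilon> \<in> ?s ` N"
    then obtain \<delta> where "\<delta> \<in> N" "\<epsilon> = ?s \<delta>" by auto
    then show "\<epsilon> \<in> Q"
      using reflection_mem_of_add_closed[OF gF Q anti[OF g], of \<delta>] cl g by (auto simp: N_def)
  qed
  have pos: "\<epsilon> \<bullet> \<gamma> > 0" if "\<epsilon> \<in> ?s ` N" for \<epsilon>
    using that by (auto simp: N_def reflection_inner_self)
  have gnot: "\<gamma> \<notin> ?s ` N"
  proof
    assume "\<gamma> \<in> ?s ` N"
    then obtain \<delta> where d: "\<delta> \<in> N" "\<gamma> = ?s \<delta>" by auto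
    then have "\<delta> = ?s \<gamma>" by (metis reflection_reflection)
    also have "?s \<gamma> = - \<gamma>" using inner_self_pos[OF gF] by (simp add: reflection_def scaleR_2)
    finally show False using d anti[OF g] by (simp add: N_def)
  qed
  have gN: "\<gamma> \<notin> N" using inner_self_pos[OF gF] by (auto simp: N_def not_less)
  have inj: "inj_on ?s N" by (metis inj_onI reflection_reflection)
  have "sum t (?s ` N) = (\<Sum>\<delta>\<in>N. t (?s \<delta>))" using sum.reindex[OF inj, of t] by simp
  also have "\<dots> = - sum t N" unfolding t_def by (simp only: reflection_coroot_inner sum_negf)
  finally have cancel: "sum t (?s ` N) + sum t N = 0" by simp
  have disj: "?s ` N \<inter> N = {}" using pos by (fastforce simp: N_def)
  let ?R = "Q - (?s ` N \<union> N)"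
  have NQ: "?s ` N \<union> N \<subseteq> Q" using sN by (auto simp: N_def)
  have "sum t Q = sum t ?R + sum t (?s ` N \<union> N)" using sum.subset_diff[OF NQ finQ] by simp
  also have "sum t (?s ` N \<union> N) = sum t (?s ` N) + sum t N"
    using disj finQ NQ by (intro sum.union_disjoint) (auto intro: finite_subset)
  also have "\<dots> = 0" by (rule cancel)
  finally have "sum t Q = sum t ?R" by simp
  also have "\<dots> \<ge> t \<gamma>"
  proof (rule member_le_sum)
    show "\<gamma> \<in> ?R" using g gnot gN by auto
    show "0 \<le> t \<delta>" if "\<delta> \<in> ?R - {\<gamma>}" for \<delta> using that by (auto simp: N_def t_def)
    show "finite ?R" using finQ by auto
  qed
  moreover have "t \<gamma> = 2" using inner_self_pos[OF gF] by (simp add: t_def)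
  ultimately show ?thesis by (simp add: coroot_sum_inner t_def)
qed

end

section \<open>Positive systems and antichains\<close>

locale positive_system = root_set \<Phi> for \<Phi> :: "'a::euclidean_space set" +
  fixes P :: "'a set"
  assumes P_sub: "P \<subseteq> \<Phi>"
    and P_total: "\<And>\<gamma>. \<gamma> \<in> \<Phi> \<Longrightarrow> \<gamma> \<in> P \<or> - \<gamma> \<in> P"
    and P_anti: "\<And>\<gamma>. \<gamma> \<in> P \<Longrightarrow> - \<gamma> \<notin> P"
    and P_add: "\<And>\<gamma> \<delta>. \<gamma> \<in> P \<Longrightarrow> \<delta> \<in> P \<Longrightarrow> \<gamma> + \<delta> \<in> \<Phi> \<Longrightarrow> \<gamma> + \<delta> \<in> P"
begin

lemma positive_functional: "\<gamma> \<in> P \<Longrightarrow> 2 \<le> coroot_sum P \<bullet> \<gamma>"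
  using coroot_sum_inner_ge_2[OF P_sub P_anti P_add] .

lemma length_le_inner_sum_list:
  "set xs \<subseteq> P \<Longrightarrow> 2 * real (length xs) \<le> coroot_sum P \<bullet> sum_list xs"
proof (induction xs)
  case Nil then show ?case by simp
next
  case (Cons a xs)
  then show ?case using positive_functional[of a] by (simp add: inner_add_right)
qed

lemma sum_list_eq_0: "set xs \<subseteq> P \<Longrightarrow> sum_list xs = 0 \<Longrightarrow> xs = []"
  using length_le_inner_sum_list[of xs] by simp

end

text \<open>
Two elements related by \<open>root_prec\<close> are required to be equal because that relation is reflexive.
\<close>

locale root_antichain = positive_system \<Phi> P for \<Phi> P :: "'a::euclidean_space set" +
  fixes A :: "'a set"
  assumes A_sub: "A \<subseteq> P"
    and A_anti: "\<And>\<alpha> \<beta>. \<alpha> \<in> A \<Longrightarrow> \<beta> \<in> A \<Longrightarrow> root_prec P \<alpha> \<beta> \<Longrightarrow> \<alpha> = \<beta>"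
begin

text \<open>
How the antichain property enters the counting: an element of \<open>A\<close> in a decomposition of
\<open>\<beta> \<in> A\<close> precedes \<open>\<beta>\<close>, hence is \<open>\<beta>\<close>, and nothing is left for the other summands.
\<close>

lemma mem_summand_eq:
  assumes "\<beta> \<in> A" "set xs \<subseteq> P" "sum_list xs = \<beta>" "\<delta> \<in> set xs" "\<delta> \<in> A"
  shows "\<delta> = \<beta> \<and> xs = [\<beta>]"
proof -
  have p: "set (remove1 \<delta> xs) \<subseteq> P" using assms(2) by (meson order_trans set_remove1_subset)
  have s: "sum_list xs = \<delta> + sum_list (remove1 \<delta> xs)"
    using assms(4) by (rule sum_list_map_remove1[of _ _ id, simplified])
  have "root_prec P \<delta> \<beta>" unfolding root_prec_def
    using p s assms(3) by (intro exI[of _ "remove1 \<delta> xs"]) auto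
  then have e: "\<delta> = \<beta>" using A_anti assms by auto
  then have "sum_list (remove1 \<delta> xs) = 0" using s assms(3) by simp
  then have r: "remove1 \<delta> xs = []" using sum_list_eq_0 p by blast
  then have "length xs = 1" using assms(4) by (metis One_nat_def Suc_pred length_pos_if_in_set length_remove1 list.size(3))
  then have "xs = [\<delta>]" using assms(4) by (cases xs) auto
  then show ?thesis using e by simp
qed

lemma diff_notin:
  assumes "\<alpha> \<in> A" "\<beta> \<in> A" "\<alpha> \<noteq> \<beta>" shows "\<alpha> - \<beta> \<notin> \<Phi>"
proof
  assume "\<alpha> - \<beta> \<in> \<Phi>"
  then have "\<alpha> - \<beta> \<in> P \<or> \<beta> - \<alpha> \<in> P" using P_total by fastforce
  then have "root_prec P \<beta> \<alpha> \<or> root_prec P \<alpha> \<beta>"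
    unfolding root_prec_def by (metis empty_set empty_subsetI insert_subset list.simps(15) sum_list.Cons sum_list.Nil add_0_right)
  then show False using A_anti assms by auto
qed

lemma inner_nonpos: "\<alpha> \<in> A \<Longrightarrow> \<beta> \<in> A \<Longrightarrow> \<alpha> \<noteq> \<beta> \<Longrightarrow> \<alpha> \<bullet> \<beta> \<le> 0"
  using diff_notin[of \<alpha> \<beta>] diff_mem[of \<alpha> \<beta>] A_sub P_sub by force

lemma finite_A: "finite A"
  using A_sub P_sub finite_roots by (meson finite_subset)

text \<open>
Pairwise obtuse vectors in an open half space are independent: separating the positive and negative
coefficients of a relation gives a vector \<open>u\<close> with \<open>(u, u) \<le> 0\<close>, and a nontrivial
positive combination of positive roots does not vanish.
\<close>

lemma independent_A: "independent A"
proof -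
  have pos_part: "c \<alpha> \<le> 0"
    if c: "(\<Sum>\<alpha>\<in>A. c \<alpha> *\<^sub>R \<alpha>) = 0" and a: "\<alpha> \<in> A" for c \<alpha>
  proof (rule ccontr)
    assume ca: "\<not> c \<alpha> \<le> 0"
    define S where "S = {\<alpha> \<in> A. c \<alpha> > 0}"
    define u where "u = (\<Sum>\<alpha>\<in>S. c \<alpha> *\<^sub>R \<alpha>)"
    have S: "S \<subseteq> A" "finite S" using finite_A by (auto simp: S_def)
    have "u + (\<Sum>\<alpha>\<in>A-S. c \<alpha> *\<^sub>R \<alpha>) = 0"
      using sum.subset_diff[OF S(1) finite_A, of "\<lambda>\<alpha>. c \<alpha> *\<^sub>R \<alpha>"] c by (simp add: u_def add.commute)
    then have u2: "u = (\<Sum>\<alpha>\<in>A-S. (- c \<alpha>) *\<^sub>R \<alpha>)" by (simp add: sum_negf eq_neg_iff_add_eq_0)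
    have "u \<bullet> u = (\<Sum>\<alpha>\<in>S. c \<alpha> *\<^sub>R \<alpha>) \<bullet> (\<Sum>\<alpha>\<in>A-S. (- c \<alpha>) *\<^sub>R \<alpha>)"
      using u2 by (simp only: u_def[symmetric])
    also have "\<dots> = (\<Sum>\<alpha>\<in>S. \<Sum>\<beta>\<in>A-S. c \<alpha> * (- c \<beta>) * (\<alpha> \<bullet> \<beta>))"
      unfolding inner_sum_left inner_sum_right inner_scaleR_left inner_scaleR_right sum_distrib_left
      by (subst sum.swap) (simp add: mult_ac)
    also have "\<dots> \<le> 0"
    proof (intro sum_nonpos)
      fix a b assume "a \<in> S" "b \<in> A - S"
      then have "c a * - c b \<ge> 0" "a \<bullet> b \<le> 0"
        using inner_nonpos[of a b] by (auto simp: S_def mult_nonneg_nonpos)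
      then show "c a * - c b * (a \<bullet> b) \<le> 0" by (rule mult_nonneg_nonpos)
    qed
    finally have "u = 0" by (metis inner_eq_zero_iff inner_ge_zero order_antisym)
    then have "0 = coroot_sum P \<bullet> u" by simp
    also have "\<dots> = (\<Sum>\<alpha>\<in>S. c \<alpha> * (coroot_sum P \<bullet> \<alpha>))" by (simp add: u_def inner_sum_right)
    also have "\<dots> > 0"
    proof (rule sum_pos)
      show "S \<noteq> {}" using a ca by (auto simp: S_def)
      fix b assume b: "b \<in> S"
      then have "coroot_sum P \<bullet> b > 0" using positive_functional[of b] S A_sub by force
      then show "c b * (coroot_sum P \<bullet> b) > 0" using b by (auto simp: S_def)
    qed (fact S)
    finally show False by simp
  qed
  show ?thesis
  proof (rule independent_if_scalars_zero[OF finite_A])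
    fix c \<alpha> assume c: "(\<Sum>\<alpha>\<in>A. c \<alpha> *\<^sub>R \<alpha>) = 0" and a: "\<alpha> \<in> A"
    have "(\<Sum>\<alpha>\<in>A. (- c \<alpha>) *\<^sub>R \<alpha>) = 0" using c by (simp add: sum_negf)
    then show "c \<alpha> = 0" using pos_part[OF c a] pos_part[of "\<lambda>\<alpha>. - c \<alpha>" \<alpha>] a by simp
  qed
qed

end

section \<open>Counting antichain elements in decompositions\<close>

definition hits :: "'a set \<Rightarrow> 'a list \<Rightarrow> nat" where
  "hits A xs = length (filter (\<lambda>\<delta>. \<delta> \<in> A) xs)"

lemma hits_simps [simp]:
  "hits A [] = 0" "hits A (x # xs) = (if x \<in> A then Suc (hits A xs) else hits A xs)"
  "hits A (xs @ ys) = hits A xs + hits A ys"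
  by (simp_all add: hits_def)

lemma hits_le_length: "hits A xs \<le> length xs"
  by (simp add: hits_def)

lemma hits_pos_iff: "0 < hits A xs \<longleftrightarrow> (\<exists>\<delta>\<in>set xs. \<delta> \<in> A)"
  by (induction xs) auto

lemma hits_remove1_le: "hits A xs \<le> Suc (hits A (remove1 x xs))"
  by (induction xs) auto

lemma hits_remove1: "x \<in> set xs \<Longrightarrow> hits A xs = hits A [x] + hits A (remove1 x xs)"
  by (induction xs) auto

lemma sum_list_remove1:
  fixes xs :: "'b::ab_group_add list"
  shows "x \<in> set xs \<Longrightarrow> sum_list (remove1 x xs) = sum_list xs - x"
  by (induction xs) auto

text \<open>
A decomposition \<open>xs\<close> of \<open>\<gamma> + \<gamma>'\<close> can be shared out between \<open>\<gamma>\<close> and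
\<open>\<gamma>'\<close> by cutting at most one summand in two. The lists \<open>ys\<close> and \<open>zs\<close> are the
uncut summands; \<open>ds\<close> and \<open>es\<close> hold the two pieces of the cut one, and are both empty if
nothing is cut. Only the cut summand can be lost from the count of elements of \<open>A\<close>.
\<close>

definition split_of :: "'a::euclidean_space set \<Rightarrow> 'a set \<Rightarrow> 'a \<Rightarrow> 'a \<Rightarrow> 'a list \<Rightarrow> bool" where
  "split_of P A \<gamma> \<gamma>' xs \<longleftrightarrow> (\<exists>ys zs ds es. set (ys @ zs @ ds @ es) \<subseteq> P \<and>
     sum_list (ds @ ys) = \<gamma> \<and> sum_list (es @ zs) = \<gamma>' \<and> length ds = length es \<and> length ds \<le> 1 \<and>
     hits A xs \<le> hits A ys + hits A zs + length ds)"

lemma split_of_commute: "split_of P A \<gamma> \<gamma>' xs \<Longrightarrow> split_of P A \<gamma>' \<gamma> xs"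
proof -
  assume "split_of P A \<gamma> \<gamma>' xs"
  then obtain ys zs ds es where "set (ys @ zs @ ds @ es) \<subseteq> P"
     "sum_list (ds @ ys) = \<gamma>" "sum_list (es @ zs) = \<gamma>'" "length ds = length es" "length ds \<le> 1"
     "hits A xs \<le> hits A ys + hits A zs + length ds"
    unfolding split_of_def by blast
  then show ?thesis unfolding split_of_def
    by (intro exI[of _ zs] exI[of _ ys] exI[of _ es] exI[of _ ds]) auto
qed

context positive_system
begin

text \<open>
Some summand \<open>\<delta>\<close> has positive inner product with \<open>\<gamma>\<close> or \<open>\<gamma>'\<close>, say
with \<open>\<gamma>\<close>, so the difference of \<open>\<gamma>\<close> and \<open>\<delta>\<close> is zero or a root. If
\<open>\<delta>\<close> is the smaller one, move it to the side of \<open>\<gamma>\<close> and continue with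
\<open>\<gamma> - \<delta>\<close>; if \<open>\<gamma>\<close> is the smaller one, cut \<open>\<delta>\<close> and stop.
\<close>

lemma sum_of_two_splits:
  assumes "\<gamma> \<in> P" "\<gamma>' \<in> P" "set xs \<subseteq> P" "sum_list xs = \<gamma> + \<gamma>'"
  shows "split_of P A \<gamma> \<gamma>' xs"
  using assms
proof (induction "length xs" arbitrary: \<gamma> \<gamma>' xs rule: less_induct)
  case less
  have step: "split_of P A \<gamma> \<gamma>' xs"
    if g: "\<gamma> \<in> P" "\<gamma>' \<in> P" and s: "sum_list xs = \<gamma> + \<gamma>'" and d: "\<delta> \<in> set xs" "\<gamma> \<bullet> \<delta> > 0"
    for \<gamma> \<gamma>' \<delta>
  proof -
    let ?xs = "remove1 \<delta> xs"
    have dP: "\<delta> \<in> P" using d less.prems by auto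
    have xsP: "set ?xs \<subseteq> P" using less.prems by (meson order_trans set_remove1_subset)
    have sx: "sum_list ?xs = \<gamma> + \<gamma>' - \<delta>" using sum_list_remove1[OF d(1)] s by simp
    have h: "hits A xs = hits A [\<delta>] + hits A ?xs" using hits_remove1[OF d(1)] .
    consider "\<gamma> = \<delta>" | "\<gamma> - \<delta> \<in> P" | "\<delta> - \<gamma> \<in> P"
      using diff_mem[of \<gamma> \<delta>] g dP P_sub d(2) P_total[of "\<gamma> - \<delta>"] by auto
    then show ?thesis
    proof cases
      case 1
      then show ?thesis unfolding split_of_def
        using h xsP dP sx
        by (intro exI[of _ "[\<delta>]"] exI[of _ ?xs] exI[of _ "[]"]) auto
    next
      case 2
      have "length ?xs < length xs" using d(1)
        by (metis length_remove1 length_pos_if_in_set diff_less zero_less_one)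
      then have "split_of P A (\<gamma> - \<delta>) \<gamma>' ?xs"
        using less.hyps[of ?xs "\<gamma> - \<delta>" \<gamma>'] 2 g xsP sx by simp
      then obtain ys zs ds es where "set (ys @ zs @ ds @ es) \<subseteq> P"
         "sum_list (ds @ ys) = \<gamma> - \<delta>" "sum_list (es @ zs) = \<gamma>'" "length ds = length es" "length ds \<le> 1"
         "hits A ?xs \<le> hits A ys + hits A zs + length ds"
        unfolding split_of_def by blast
      then show ?thesis unfolding split_of_def using h dP
        by (intro exI[of _ "\<delta> # ys"] exI[of _ zs] exI[of _ ds] exI[of _ es]) (auto simp: algebra_simps)
    next
      case 3
      then show ?thesis unfolding split_of_def
        using hits_remove1_le[of A xs \<delta>] xsP dP sx g
        by (intro exI[of _ "[]"] exI[of _ ?xs] exI[of _ "[\<gamma>]"] exI[of _ "[\<delta> - \<gamma>]"]) auto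
    qed
  qed
  have "coroot_sum P \<bullet> (\<gamma> + \<gamma>') > 0"
    using positive_functional[of \<gamma>] positive_functional[of \<gamma>'] less.prems by (simp add: inner_add_right)
  then have "\<gamma> + \<gamma>' \<noteq> 0" by auto
  then have pos: "0 < (\<gamma> + \<gamma>') \<bullet> sum_list xs" using less.prems(4) by simp
  have "(\<gamma> + \<gamma>') \<bullet> sum_list xs \<le> 0" if "\<forall>\<delta>\<in>set xs. (\<gamma> + \<gamma>') \<bullet> \<delta> \<le> 0"
    using that by (induction xs) (auto simp: inner_add_right)
  then obtain \<delta> where d: "\<delta> \<in> set xs" "(\<gamma> + \<gamma>') \<bullet> \<delta> > 0" using pos by (meson not_le)
  then have "\<gamma> \<bullet> \<delta> > 0 \<or> \<gamma>' \<bullet> \<delta> > 0" by (auto simp: inner_add_left)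
  then show ?case
  proof
    assume "\<gamma> \<bullet> \<delta> > 0"
    then show ?thesis using step d less.prems by blast
  next
    assume "\<gamma>' \<bullet> \<delta> > 0"
    then have "split_of P A \<gamma>' \<gamma> xs" using step[of \<gamma>' \<gamma> \<delta>] d less.prems by (simp add: add.commute)
    then show ?thesis by (rule split_of_commute)
  qed
qed

end

context root_antichain
begin

definition depth :: "'a \<Rightarrow> nat" where
  "depth v = Max {hits A xs | xs. set xs \<subseteq> P \<and> sum_list xs = v}"

lemma finite_hits: "finite {hits A xs | xs. set xs \<subseteq> P \<and> sum_list xs = v}"
proof (rule finite_subset)
  show "{hits A xs | xs. set xs \<subseteq> P \<and> sum_list xs = v} \<subseteq> {n. real n \<le> coroot_sum P \<bullet> v}"
  proof clarify
    fix xs assume "set xs \<subseteq> P"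
    then show "real (hits A xs) \<le> coroot_sum P \<bullet> sum_list xs"
      using length_le_inner_sum_list[of xs] hits_le_length[of A xs] by linarith
  qed
  show "finite {n. real n \<le> coroot_sum P \<bullet> v}"
    by (rule finite_subset[of _ "{..nat \<lfloor>coroot_sum P \<bullet> v\<rfloor>}"]) (auto simp: le_nat_floor)
qed

lemma hits_le_depth: "set xs \<subseteq> P \<Longrightarrow> hits A xs \<le> depth (sum_list xs)"
  unfolding depth_def by (rule Max_ge[OF finite_hits]) blast

lemma depth_attained:
  assumes "\<gamma> \<in> P" shows "\<exists>xs. set xs \<subseteq> P \<and> sum_list xs = \<gamma> \<and> hits A xs = depth \<gamma>"
proof -
  have "{hits A xs | xs. set xs \<subseteq> P \<and> sum_list xs = \<gamma>} \<noteq> {}"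
    using assms by (auto intro!: exI[of _ "[\<gamma>]"])
  from Max_in[OF finite_hits this] show ?thesis unfolding depth_def by fastforce
qed

lemma depth_superadditive:
  assumes "\<gamma> \<in> P" "\<delta> \<in> P" shows "depth \<gamma> + depth \<delta> \<le> depth (\<gamma> + \<delta>)"
proof -
  obtain xs ys where "set xs \<subseteq> P" "sum_list xs = \<gamma>" "hits A xs = depth \<gamma>"
    "set ys \<subseteq> P" "sum_list ys = \<delta>" "hits A ys = depth \<delta>"
    using depth_attained assms by metis
  then show ?thesis using hits_le_depth[of "xs @ ys"] by simp
qed

lemma depth_add_le:
  assumes "\<gamma> \<in> P" "\<delta> \<in> P" "\<gamma> + \<delta> \<in> P" shows "depth (\<gamma> + \<delta>) \<le> depth \<gamma> + depth \<delta> + 1"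
proof -
  obtain xs where xs: "set xs \<subseteq> P" "sum_list xs = \<gamma> + \<delta>" "hits A xs = depth (\<gamma> + \<delta>)"
    using depth_attained assms by metis
  obtain ys zs ds es where *: "set (ys @ zs @ ds @ es) \<subseteq> P"
     "sum_list (ds @ ys) = \<gamma>" "sum_list (es @ zs) = \<delta>" "length ds \<le> 1"
     "hits A xs \<le> hits A ys + hits A zs + length ds"
    using sum_of_two_splits[OF assms(1,2) xs(1,2)] unfolding split_of_def by blast
  have "hits A (ds @ ys) \<le> depth \<gamma>" "hits A (es @ zs) \<le> depth \<delta>"
    using hits_le_depth[of "ds @ ys"] hits_le_depth[of "es @ zs"] * by auto
  then show ?thesis using * xs(3) by simp
qed

text \<open>
The values at and below the elements of \<open>A\<close>: by the antichain property a decomposition of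
\<open>\<beta> \<in> A\<close> other than the trivial one contains no element of \<open>A\<close>.
\<close>

lemma depth_antichain:
  assumes "\<beta> \<in> A" shows "depth \<beta> = 1"
proof -
  have bP: "\<beta> \<in> P" using assms A_sub by auto
  obtain xs where xs: "set xs \<subseteq> P" "sum_list xs = \<beta>" "hits A xs = depth \<beta>"
    using depth_attained[OF bP] by auto
  have "depth \<beta> \<ge> 1" using hits_le_depth[of "[\<beta>]"] bP assms by simp
  then have "0 < hits A xs" using xs by simp
  then obtain \<delta> where "\<delta> \<in> set xs" "\<delta> \<in> A" unfolding hits_pos_iff by auto
  then have "xs = [\<beta>]" using mem_summand_eq[OF assms xs(1,2)] by auto
  then show ?thesis using xs assms by simp
qed

lemma depth_summand:
  assumes "\<beta> \<in> A" "\<gamma> \<in> P" "\<delta> \<in> P" "\<gamma> + \<delta> = \<beta>" shows "depth \<gamma> = 0"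
proof (rule ccontr)
  assume n: "depth \<gamma> \<noteq> 0"
  obtain xs where xs: "set xs \<subseteq> P" "sum_list xs = \<gamma>" "hits A xs = depth \<gamma>"
    using depth_attained[OF assms(2)] by auto
  then obtain \<alpha> where "\<alpha> \<in> set xs" "\<alpha> \<in> A" using n hits_pos_iff[of A xs] by auto
  then have "\<delta> # xs = [\<beta>]"
    using mem_summand_eq[OF assms(1), of "\<delta> # xs" \<alpha>] xs assms by (simp add: add.commute)
  then show False using \<open>\<alpha> \<in> set xs\<close> by simp
qed

text \<open>
The bound \<open>depth_add_le\<close> only gives \<open>depth \<gamma> + 2\<close> here. It improves because
cutting a summand and having an element of \<open>A\<close> on the side of \<open>\<beta>\<close> exclude each other.
\<close>

lemma depth_add_antichain:
  assumes b: "\<beta> \<in> A" and g: "\<gamma> \<in> P" "\<gamma> + \<beta> \<in> P" shows "depth (\<gamma> + \<beta>) = depth \<gamma> + 1"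
proof (rule antisym)
  have bP: "\<beta> \<in> P" using b A_sub by auto
  show "depth \<gamma> + 1 \<le> depth (\<gamma> + \<beta>)"
    using depth_superadditive[OF g(1) bP] depth_antichain[OF b] by simp
  obtain xs where xs: "set xs \<subseteq> P" "sum_list xs = \<beta> + \<gamma>" "hits A xs = depth (\<gamma> + \<beta>)"
    using depth_attained[OF g(2)] by (metis add.commute)
  obtain ys zs ds es where *: "set (ys @ zs @ ds @ es) \<subseteq> P"
     "sum_list (ds @ ys) = \<beta>" "sum_list (es @ zs) = \<gamma>" "length ds \<le> 1"
     "hits A xs \<le> hits A ys + hits A zs + length ds"
    using sum_of_two_splits[OF bP g(1) xs(1,2)] unfolding split_of_def by blast
  have zs: "hits A zs \<le> depth \<gamma>" using hits_le_depth[of "es @ zs"] * by auto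
  have "hits A ys + length ds \<le> 1"
  proof (cases "ds = []")
    case True
    then show ?thesis using hits_le_depth[of ys] depth_antichain[OF b] * by simp
  next
    case False
    have "hits A ys = 0"
    proof (rule ccontr)
      assume "hits A ys \<noteq> 0"
      then obtain \<delta> where d: "\<delta> \<in> set ys" "\<delta> \<in> A" using hits_pos_iff[of A ys] by auto
      then have "ds @ ys = [\<beta>]" using mem_summand_eq[OF b, of "ds @ ys" \<delta>] * by auto
      then show False using False d by (cases ds) auto
    qed
    then show ?thesis using * by simp
  qed
  then show "depth (\<gamma> + \<beta>) \<le> depth \<gamma> + 1" using * zs xs(3) by simp
qed

text \<open>
The value at a negative root is chosen so that \<open>level \<gamma> \<le> (y, \<gamma>) \<le> level \<gamma> + 1\<close>
is the same condition on a point \<open>y\<close> for \<open>\<gamma>\<close> and for \<open>-\<gamma>\<close>. With this choice the upper and lower bounds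
for \<open>depth\<close> combine into superadditivity on all roots.
\<close>

definition level :: "'a \<Rightarrow> int" where
  "level \<gamma> = (if \<gamma> \<in> P then int (depth \<gamma>) else - int (depth (- \<gamma>)) - 1)"

lemma level_pos: "\<gamma> \<in> P \<Longrightarrow> level \<gamma> = int (depth \<gamma>)"
  by (simp add: level_def)

lemma level_neg: "\<gamma> \<in> P \<Longrightarrow> level (- \<gamma>) = - int (depth \<gamma>) - 1"
  using P_anti by (simp add: level_def)

lemma level_uminus: "\<gamma> \<in> \<Phi> \<Longrightarrow> level (- \<gamma>) = - level \<gamma> - 1"
  using P_total[of \<gamma>] level_pos level_neg by fastforce

lemma level_superadditive:
  assumes "\<gamma> \<in> \<Phi>" "\<delta> \<in> \<Phi>" "\<gamma> + \<delta> \<in> \<Phi>" shows "level \<gamma> + level \<delta> \<le> level (\<gamma> + \<delta>)"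
proof -
  have mixed: "level \<gamma> + level (- \<delta>) \<le> level (\<gamma> - \<delta>)"
    if "\<gamma> \<in> P" "\<delta> \<in> P" "\<gamma> - \<delta> \<in> \<Phi>" for \<gamma> \<delta>
  proof (cases "\<gamma> - \<delta> \<in> P")
    case True
    have "depth (\<delta> + (\<gamma> - \<delta>)) \<le> depth \<delta> + depth (\<gamma> - \<delta>) + 1"
      using depth_add_le[of \<delta> "\<gamma> - \<delta>"] that True by simp
    then show ?thesis using that True by (simp add: level_pos level_neg)
  next
    case False
    then have n: "\<delta> - \<gamma> \<in> P" using P_total[OF that(3)] by simp
    have "depth \<gamma> + depth (\<delta> - \<gamma>) \<le> depth \<delta>"
      using depth_superadditive[OF that(1) n] by simp
    then show ?thesis using that level_neg[OF n] by (simp add: level_pos level_neg)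
  qed
  consider "\<gamma> \<in> P" "\<delta> \<in> P" | "\<gamma> \<in> P" "- \<delta> \<in> P" | "- \<gamma> \<in> P" "\<delta> \<in> P" | "- \<gamma> \<in> P" "- \<delta> \<in> P"
    using P_total assms by blast
  then show ?thesis
  proof cases
    case 1
    then show ?thesis using depth_superadditive[OF 1] P_add[OF 1 assms(3)] by (simp add: level_pos)
  next
    case 2
    then show ?thesis using mixed[of \<gamma> "- \<delta>"] assms by simp
  next
    case 3
    then show ?thesis using mixed[of \<delta> "- \<gamma>"] assms by (simp add: add.commute)
  next
    case 4
    have s: "- \<gamma> + - \<delta> \<in> P" using P_add[OF 4] uminus_mem[OF assms(3)] by simp
    then show ?thesis
      using depth_add_le[OF 4 s] level_neg[OF s] level_neg[OF 4(1)] level_neg[OF 4(2)]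
      by (simp add: add.commute)
  qed
qed

lemma level_add_antichain:
  assumes b: "\<beta> \<in> A" and g: "\<gamma> \<in> \<Phi>" "\<gamma> + \<beta> \<in> \<Phi>" shows "level (\<gamma> + \<beta>) = level \<gamma> + 1"
proof -
  have bP: "\<beta> \<in> P" using b A_sub by auto
  consider "\<gamma> \<in> P" "\<gamma> + \<beta> \<in> P" | "- \<gamma> \<in> P" "\<gamma> + \<beta> \<in> P" | "- \<gamma> \<in> P" "- (\<gamma> + \<beta>) \<in> P"
    using P_total[OF g(1)] P_total[OF g(2)] P_add[OF _ bP g(2)] by blast
  then show ?thesis
  proof cases
    case 1
    then show ?thesis using depth_add_antichain[OF b] by (simp add: level_pos)
  next
    case 2
    have "depth (- \<gamma>) = 0" "depth (\<gamma> + \<beta>) = 0"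
      using depth_summand[OF b 2(1,2)] depth_summand[OF b 2(2,1)] by auto
    then show ?thesis using level_pos[OF 2(2)] level_neg[OF 2(1)] by simp
  next
    case 3
    have "depth (- (\<gamma> + \<beta>) + \<beta>) = depth (- (\<gamma> + \<beta>)) + 1"
      using depth_add_antichain[OF b 3(2)] 3(1) by simp
    then show ?thesis using level_neg[OF 3(2)] level_neg[OF 3(1)] by (simp add: add.commute)
  qed
qed

lemma level_antichain: "\<beta> \<in> A \<Longrightarrow> level \<beta> = 1"
  using depth_antichain level_pos A_sub by fastforce

end

section \<open>The dual point of a spanning antichain\<close>

lemma independent_ex_functional:
  fixes A :: "'a::euclidean_space set"
  assumes "independent A" shows "\<exists>x. \<forall>\<beta>\<in>A. x \<bullet> \<beta> = 1"
proof -
  obtain f :: "'a \<Rightarrow> real" where f: "linear f" "\<forall>\<beta>\<in>A. f \<beta> = 1"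
    using linear_independent_extend[OF assms, of "\<lambda>_. 1"] by auto
  have "(\<Sum>b\<in>Basis. f b *\<^sub>R b) \<bullet> \<beta> = f \<beta>" for \<beta>
  proof -
    have "f \<beta> = f (\<Sum>b\<in>Basis. (\<beta> \<bullet> b) *\<^sub>R b)" by (simp add: euclidean_representation)
    also have "\<dots> = (\<Sum>b\<in>Basis. (\<beta> \<bullet> b) * f b)"
      using f(1) by (simp add: linear_sum linear_cmul)
    finally show ?thesis by (simp add: inner_sum_left inner_commute[of \<beta>] mult.commute)
  qed
  then show ?thesis using f(2) by (intro exI[of _ "\<Sum>b\<in>Basis. f b *\<^sub>R b"]) simp
qed

context root_antichain
begin

text \<open>
Both terms grow by \<open>1\<close> when \<open>\<beta>\<close> is added, so their difference is constant along
\<open>\<beta>\<close>-strings. The string through \<open>\<beta>\<close> itself is excluded, since it is interrupted at \<open>0\<close>.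
\<close>

lemma level_minus_dual_reflection:
  assumes x: "\<forall>\<beta>\<in>A. x \<bullet> \<beta> = 1" and b: "\<beta> \<in> A"
    and g: "\<gamma> \<in> \<Phi>" "\<gamma> \<noteq> \<beta>" "\<gamma> \<noteq> - \<beta>"
  shows "level (reflection \<beta> \<gamma>) - x \<bullet> reflection \<beta> \<gamma> = level \<gamma> - x \<bullet> \<gamma>"
proof -
  have bF: "\<beta> \<in> \<Phi>" using b A_sub P_sub by auto
  define Q where "Q = {\<delta> \<in> \<Phi> - {\<beta>, - \<beta>}. level \<delta> - x \<bullet> \<delta> = level \<gamma> - x \<bullet> \<gamma>}"
  have no_double: "2 *\<^sub>R \<beta> \<notin> \<Phi>" "(-2) *\<^sub>R \<beta> \<notin> \<Phi>" using reduced[OF bF] by fastforce+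
  have Q: "Q \<subseteq> \<Phi>" "\<beta> \<notin> Q" "- \<beta> \<notin> Q" "\<gamma> \<in> Q" using g by (auto simp: Q_def)
  have up: "\<delta> + \<beta> \<in> Q" if "\<delta> \<in> Q" "\<delta> + \<beta> \<in> \<Phi>" for \<delta>
  proof -
    have "\<delta> \<in> \<Phi>" using that Q by auto
    have "\<delta> + \<beta> \<noteq> \<beta>" using \<open>\<delta> \<in> \<Phi>\<close> zero_notin by auto
    moreover have "\<delta> + \<beta> \<noteq> - \<beta>"
    proof
      assume "\<delta> + \<beta> = - \<beta>"
      then have "\<delta> = (-2) *\<^sub>R \<beta>" by (simp add: scaleR_2 eq_neg_iff_add_eq_0 algebra_simps)
      then show False using \<open>\<delta> \<in> \<Phi>\<close> no_double by simp
    qed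
    ultimately show ?thesis
      using that level_add_antichain[OF b \<open>\<delta> \<in> \<Phi>\<close> that(2)] x b by (simp add: Q_def inner_add_right)
  qed
  have down: "\<delta> + - \<beta> \<in> Q" if "\<delta> \<in> Q" "\<delta> + - \<beta> \<in> \<Phi>" for \<delta>
  proof -
    have "\<delta> \<in> \<Phi>" using that Q by auto
    have "\<delta> - \<beta> \<noteq> - \<beta>" using \<open>\<delta> \<in> \<Phi>\<close> zero_notin by auto
    moreover have "\<delta> - \<beta> \<noteq> \<beta>"
    proof
      assume "\<delta> - \<beta> = \<beta>"
      then have "\<delta> = 2 *\<^sub>R \<beta>" by (simp add: scaleR_2 algebra_simps)
      then show False using \<open>\<delta> \<in> \<Phi>\<close> no_double by simp
    qed
    moreover have "level \<delta> = level (\<delta> - \<beta>) + 1"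
      using level_add_antichain[OF b, of "\<delta> - \<beta>"] that \<open>\<delta> \<in> \<Phi>\<close> by simp
    ultimately show ?thesis using that x b by (simp add: Q_def inner_diff_right)
  qed
  have "reflection \<beta> \<gamma> \<in> Q"
  proof (cases "\<gamma> \<bullet> \<beta> \<le> 0")
    case True
    then show ?thesis using reflection_mem_of_add_closed[OF bF Q(1,3) up Q(4)] by simp
  next
    case False
    then show ?thesis
      using reflection_mem_of_add_closed[OF uminus_mem[OF bF] Q(1) _ down Q(4)] Q(2) by simp
  qed
  then show ?thesis by (simp add: Q_def)
qed

text \<open>
The roots \<open>\<gamma>\<close> with \<open>(x, \<gamma>) \<le> level \<gamma>\<close> form a set \<open>Q\<close> whose coroot sum
acts as \<open>2 x\<close> on the span of \<open>A\<close>. This makes \<open>2 (x, \<gamma>)\<close> an integer and, by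
\<open>coroot_sum_inner_ge_2\<close>, makes \<open>(x, \<gamma>) \<ge> 1\<close> on \<open>Q\<close>. For a positive root
outside \<open>Q\<close> positivity is immediate, because its level is nonnegative.
\<close>

lemma dual_point_pos_half_integral:
  assumes x: "\<forall>\<beta>\<in>A. x \<bullet> \<beta> = 1" and spn: "P \<subseteq> span A" and g: "\<gamma> \<in> P"
  shows "2 * (x \<bullet> \<gamma>) \<in> \<int>" and "0 < x \<bullet> \<gamma>"
proof -
  define f where "f \<delta> = level \<delta> - x \<bullet> \<delta>" for \<delta>
  define Q where "Q = {\<delta> \<in> \<Phi>. 0 \<le> f \<delta>}"
  have Q: "Q \<subseteq> \<Phi>" and finQ: "finite Q" using finite_roots by (auto simp: Q_def)
  have f_uminus: "f (- \<delta>) = - f \<delta> - 1" if "\<delta> \<in> \<Phi>" for \<delta>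
    using level_uminus[OF that] by (simp add: f_def)
  have Q_anti: "- \<delta> \<notin> Q" if "\<delta> \<in> Q" for \<delta>
    using f_uminus[of \<delta>] that by (auto simp: Q_def)
  have Q_add: "\<delta> + \<epsilon> \<in> Q" if "\<delta> \<in> Q" "\<epsilon> \<in> Q" "\<delta> + \<epsilon> \<in> \<Phi>" for \<delta> \<epsilon>
  proof -
    have "level \<delta> + level \<epsilon> \<le> level (\<delta> + \<epsilon>)"
      using level_superadditive that Q by auto
    then have "f \<delta> + f \<epsilon> \<le> f (\<delta> + \<epsilon>)" by (simp add: f_def inner_add_right)
    then show ?thesis using that by (simp add: Q_def)
  qed
  \<comment> \<open>The reflection in \<open>\<beta>\<close> permutes \<open>Q - {\<beta>}\<close> and negates the terms, so only \<open>\<beta>\<close> itself contributes.\<close>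
  have R: "coroot_sum Q \<bullet> \<beta> = 2" if b: "\<beta> \<in> A" for \<beta>
  proof -
    have bF: "\<beta> \<in> \<Phi>" using b A_sub P_sub by auto
    have bQ: "\<beta> \<in> Q" using level_antichain[OF b] x b bF by (simp add: Q_def f_def)
    define t where "t \<delta> = 2 * (\<delta> \<bullet> \<beta>) / (\<delta> \<bullet> \<delta>)" for \<delta>
    let ?Q = "Q - {\<beta>}"
    have s: "reflection \<beta> \<delta> \<in> ?Q" if d: "\<delta> \<in> ?Q" for \<delta>
    proof -
      have dF: "\<delta> \<in> \<Phi>" "\<delta> \<noteq> \<beta>" "\<delta> \<noteq> - \<beta>" using d Q Q_anti[OF bQ] by auto
      have "reflection \<beta> \<delta> \<noteq> \<beta>"
      proof
        assume "reflection \<beta> \<delta> = \<beta>"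
        then have "\<delta> = reflection \<beta> \<beta>" by (metis reflection_reflection)
        also have "\<dots> = - \<beta>" using inner_self_pos[OF bF] by (simp add: reflection_def scaleR_2)
        finally show False using dF by simp
      qed
      moreover have "f (reflection \<beta> \<delta>) = f \<delta>"
        using level_minus_dual_reflection[OF x b dF] by (simp add: f_def)
      ultimately show ?thesis using d reflection_mem[OF bF dF(1)] by (simp add: Q_def)
    qed
    have "sum t ?Q = (\<Sum>\<delta>\<in>?Q. t (reflection \<beta> \<delta>))"
      using s by (intro sum.reindex_bij_witness[of _ "reflection \<beta>" "reflection \<beta>"]) auto
    also have "\<dots> = - sum t ?Q" unfolding t_def by (simp only: reflection_coroot_inner sum_negf)
    finally have "sum t ?Q = 0" by simp
    moreover have "sum t Q = t \<beta> + sum t ?Q" using sum.remove[OF finQ bQ] .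
    moreover have "t \<beta> = 2" using inner_self_pos[OF bF] by (simp add: t_def)
    ultimately show ?thesis by (simp add: coroot_sum_inner t_def)
  qed
  have twice: "coroot_sum Q \<bullet> \<delta> = 2 * (x \<bullet> \<delta>)" if "\<delta> \<in> span A" for \<delta>
    using that
  proof (induction rule: span_induct_alt)
    case base then show ?case by simp
  next
    case (step c \<beta> v)
    then show ?case using R x by (simp add: inner_add_right algebra_simps)
  qed
  have gF: "\<gamma> \<in> \<Phi>" using g P_sub by auto
  have g2: "coroot_sum Q \<bullet> \<gamma> = 2 * (x \<bullet> \<gamma>)" using twice g spn by auto
  then show "2 * (x \<bullet> \<gamma>) \<in> \<int>" using coroot_sum_inner_Ints[OF Q gF] by simp
  show "0 < x \<bullet> \<gamma>"
  proof (cases "\<gamma> \<in> Q")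
    case True
    then show ?thesis using coroot_sum_inner_ge_2[OF Q Q_anti Q_add] g2 by fastforce
  next
    case False
    then have "level \<gamma> < x \<bullet> \<gamma>" using gF by (simp add: Q_def f_def)
    then show ?thesis using level_pos[OF g] by simp
  qed
qed

end

section \<open>Spanning antichains are bases\<close>

context positive_system
begin

text \<open>
The height, the functional equal to \<open>1\<close> on the base, is at least \<open>1\<close> on every positive
root, so two base elements never differ by a nonempty sum of positive roots. This makes the results on
antichains, such as obtuseness, available for the base.
\<close>

lemma base_is_antichain:
  assumes J: "J \<subseteq> P" and ind: "independent J"
    and gen: "\<And>\<gamma>. \<gamma> \<in> P \<Longrightarrow> \<exists>xs. set xs \<subseteq> J \<and> sum_list xs = \<gamma>"
  shows "root_antichain \<Phi> P J"
proof
  obtain h where h: "\<forall>\<alpha>\<in>J. h \<bullet> \<alpha> = 1" using independent_ex_functional[OF ind] by auto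
  have hlen: "h \<bullet> sum_list xs = length xs" if "set xs \<subseteq> J" for xs
    using that h by (induction xs) (auto simp: inner_add_right)
  have h1: "1 \<le> h \<bullet> \<gamma>" if g: "\<gamma> \<in> P" for \<gamma>
  proof -
    obtain xs where xs: "set xs \<subseteq> J" "sum_list xs = \<gamma>" using gen[OF g] by auto
    then have "xs \<noteq> []" using g P_sub zero_notin by auto
    then show ?thesis using hlen[OF xs(1)] xs(2) by (cases xs) auto
  qed
  have hP: "length xs \<le> h \<bullet> sum_list xs" if "set xs \<subseteq> P" for xs
    using that
  proof (induction xs)
    case (Cons a xs) then show ?case using h1[of a] by (simp add: inner_add_right)
  qed simp
  fix \<alpha> \<beta> assume ab: "\<alpha> \<in> J" "\<beta> \<in> J" "root_prec P \<alpha> \<beta>"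
  then obtain xs where xs: "set xs \<subseteq> P" "\<beta> - \<alpha> = sum_list xs" by (auto simp: root_prec_def)
  have "h \<bullet> sum_list xs = 0" using h ab by (simp add: xs(2)[symmetric] inner_diff_right)
  then have "xs = []" using hP[OF xs(1)] by simp
  then show "\<alpha> = \<beta>" using xs by simp
qed (fact J)

end

context root_antichain
begin

text \<open>
The product of the two Cartan integers is a positive integer and equals four times the squared cosine.
Orthogonality is impossible, since reflecting \<open>\<alpha> + \<beta>\<close> would make \<open>\<alpha> - \<beta>\<close> a root.
\<close>

lemma cosine_le_neg_half:
  assumes "\<alpha> \<in> A" "\<beta> \<in> A" "\<alpha> \<noteq> \<beta>" "\<alpha> + \<beta> \<in> \<Phi>"
  shows "(\<alpha> \<bullet> \<beta>) / (norm \<alpha> * norm \<beta>) \<le> - 1/2"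
proof -
  have F: "\<alpha> \<in> \<Phi>" "\<beta> \<in> \<Phi>" using assms A_sub P_sub by auto
  have pos: "\<alpha> \<bullet> \<alpha> > 0" "\<beta> \<bullet> \<beta> > 0" using F inner_self_pos by auto
  have ne: "\<alpha> \<bullet> \<beta> \<noteq> 0"
  proof
    assume z: "\<alpha> \<bullet> \<beta> = 0"
    have "reflection \<beta> (\<alpha> + \<beta>) = \<alpha> - \<beta>"
      using z pos by (simp add: reflection_def inner_add_left scaleR_2)
    then show False using reflection_mem[OF F(2) assms(4)] diff_notin[OF assms(1-3)] by simp
  qed
  then have neg: "\<alpha> \<bullet> \<beta> < 0" using inner_nonpos[OF assms(1-3)] by simp
  define m where "m = 2 * (\<alpha> \<bullet> \<beta>) / (\<beta> \<bullet> \<beta>)"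
  define n where "n = 2 * (\<beta> \<bullet> \<alpha>) / (\<alpha> \<bullet> \<alpha>)"
  have "m \<in> \<int>" "n \<in> \<int>" using cartan_Ints F by (auto simp: m_def n_def)
  moreover have "m < 0" "n < 0" using neg pos
    by (auto simp: m_def n_def inner_commute divide_less_0_iff)
  ultimately have "m \<le> -1" "n \<le> -1" by (auto elim!: Ints_cases)
  then have "1 \<le> m * n" using mult_mono[of 1 "- m" 1 "- n"] by simp
  also have "m * n = 4 * ((\<alpha> \<bullet> \<beta>) / (norm \<alpha> * norm \<beta>))\<^sup>2"
    by (simp add: m_def n_def inner_commute power2_eq_square dot_square_norm field_simps)
  finally have "(1/2)\<^sup>2 \<le> (- ((\<alpha> \<bullet> \<beta>) / (norm \<alpha> * norm \<beta>)))\<^sup>2" by (simp add: power2_eq_square mult_ac)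
  moreover have "0 \<le> - ((\<alpha> \<bullet> \<beta>) / (norm \<alpha> * norm \<beta>))"
    using neg by (simp add: divide_nonpos_nonneg)
  ultimately have "1/2 \<le> - ((\<alpha> \<bullet> \<beta>) / (norm \<alpha> * norm \<beta>))" by (rule power2_le_imp_le)
  then show ?thesis by linarith
qed

text \<open>
The classical reason why a Dynkin diagram has no cycles: the sum \<open>v\<close> of the normalised vectors
has positive square length, each vector contributes \<open>1\<close> to it, and each edge contributes at most
\<open>-1\<close>. The edges are represented here by the sums of their end points.
\<close>

lemma card_edges_less:
  assumes S: "S \<subseteq> A" "S \<noteq> {}"
    and E: "E \<subseteq> \<Phi>" "\<And>\<beta>. \<beta> \<in> E \<Longrightarrow> \<exists>\<alpha>\<in>S. \<exists>\<alpha>'\<in>S. \<alpha> \<noteq> \<alpha>' \<and> \<beta> = \<alpha> + \<alpha>'"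
  shows "card E < card S"
proof -
  have finS: "finite S" using S finite_A finite_subset by auto
  have finE: "finite E" using E(1) finite_roots finite_subset by auto
  obtain p q where pq: "\<And>\<beta>. \<beta> \<in> E \<Longrightarrow> p \<beta> \<in> S \<and> q \<beta> \<in> S \<and> p \<beta> \<noteq> q \<beta> \<and> \<beta> = p \<beta> + q \<beta>"
    using E(2) by metis
  have ne: "p \<beta> \<noteq> q \<beta>" if "\<beta> \<in> E" for \<beta> using pq[OF that] by blast
  have mem: "p \<beta> \<in> S" "q \<beta> \<in> S" if "\<beta> \<in> E" for \<beta> using pq[OF that] by blast+
  define w where "w = (\<lambda>(\<alpha> :: 'a, \<alpha>' :: 'a). (\<alpha> \<bullet> \<alpha>') / (norm \<alpha> * norm \<alpha>'))"
  define v where "v = (\<Sum>\<alpha>\<in>S. (1 / norm \<alpha>) *\<^sub>R \<alpha>)"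
  \<comment> \<open>The square length is a sum over ordered pairs, so each edge occurs twice, in \<open>E1\<close> and in \<open>E2\<close>.\<close>
  define D where "D = (\<lambda>\<alpha>. (\<alpha>, \<alpha>)) ` S"
  define E1 where "E1 = (\<lambda>\<beta>. (p \<beta>, q \<beta>)) ` E"
  define E2 where "E2 = (\<lambda>\<beta>. (q \<beta>, p \<beta>)) ` E"
  have S0: "norm \<alpha> \<noteq> 0" if "\<alpha> \<in> S" for \<alpha>
    using that S A_sub P_sub zero_notin by auto
  have "v \<noteq> 0"
  proof
    assume "v = 0"
    then have "1 / norm \<alpha> = 0" if "\<alpha> \<in> S" for \<alpha>
      using independentD[OF independent_A finS S(1), of "\<lambda>\<alpha>. 1 / norm \<alpha>"] that by (simp add: v_def)
    then show False using S0 S(2) by auto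
  qed
  then have "0 < v \<bullet> v" by simp
  also have "v \<bullet> v = (\<Sum>\<alpha>\<in>S. \<Sum>\<alpha>'\<in>S. w (\<alpha>', \<alpha>))"
    by (simp add: v_def w_def inner_sum_left inner_sum_right mult.commute sum_divide_distrib)
  also have "\<dots> = sum w (S \<times> S)"
    by (subst sum.swap) (simp add: sum.cartesian_product)
  also have "\<dots> = sum w (S \<times> S - D) + sum w D"
    using finS by (intro sum.subset_diff) (auto simp: D_def)
  also have "sum w D = card S"
  proof -
    have "sum w D = (\<Sum>\<alpha>\<in>S. w (\<alpha>, \<alpha>))"
      unfolding D_def by (subst sum.reindex) (auto simp: inj_on_def)
    also have "\<dots> = (\<Sum>\<alpha>\<in>S. 1)"
      using S0 by (intro sum.cong) (auto simp: w_def dot_square_norm power2_eq_square)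
    finally show ?thesis by simp
  qed
  also have "sum w (S \<times> S - D) \<le> - real (card E)"
  proof -
    have sub: "E1 \<union> E2 \<subseteq> S \<times> S - D" using ne ne[symmetric] mem by (auto simp: E1_def E2_def D_def)
    have fin: "finite (S \<times> S - D)" using finS by auto
    have "w z \<le> 0" if zSD: "z \<in> S \<times> S - D" for z
    proof -
      obtain a b where z: "z = (a, b)" "a \<in> S" "b \<in> S" "a \<noteq> b" using zSD by (auto simp: D_def)
      then have "a \<bullet> b \<le> 0" using inner_nonpos S by auto
      then show ?thesis using z by (simp add: w_def divide_nonpos_nonneg)
    qed
    then have "sum w (S \<times> S - D) \<le> sum w (E1 \<union> E2)"
      using sum.subset_diff[OF sub fin, of w] sum_nonpos[of "S \<times> S - D - (E1 \<union> E2)" w] by auto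
    also have "\<dots> \<le> (\<Sum>z\<in>E1 \<union> E2. - 1/2)"
    proof (rule sum_mono)
      fix z assume "z \<in> E1 \<union> E2"
      then obtain \<beta> where b: "\<beta> \<in> E" "z = (p \<beta>, q \<beta>) \<or> z = (q \<beta>, p \<beta>)"
        by (auto simp: E1_def E2_def)
      have "\<beta> = p \<beta> + q \<beta>" using pq[OF b(1)] by (elim conjE)
      moreover have "\<beta> \<in> \<Phi>" using b(1) E(1) by (rule rev_subsetD)
      ultimately have sF: "p \<beta> + q \<beta> \<in> \<Phi>" by (rule subst)
      have m: "p \<beta> \<in> A" "q \<beta> \<in> A" "p \<beta> \<noteq> q \<beta>" "p \<beta> + q \<beta> \<in> \<Phi>"
        using ne[OF b(1)] mem[OF b(1)] S(1) sF by auto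
      from cosine_le_neg_half[OF m] have "w (p \<beta>, q \<beta>) \<le> - 1/2" by (simp add: w_def)
      moreover have "w (q \<beta>, p \<beta>) = w (p \<beta>, q \<beta>)" by (simp add: w_def inner_commute mult.commute)
      ultimately show "w z \<le> - 1/2" using b(2) by auto
    qed
    also have "\<dots> = - real (card (E1 \<union> E2)) / 2" by simp
    also have "card (E1 \<union> E2) = 2 * card E"
    proof -
      have sum_eq: "p \<beta> + q \<beta> = \<beta>" "q \<beta> + p \<beta> = \<beta>" if "\<beta> \<in> E" for \<beta>
      proof -
        have "\<beta> = p \<beta> + q \<beta>" using pq[OF that] by (elim conjE)
        then show "p \<beta> + q \<beta> = \<beta>" by (rule sym)
        then show "q \<beta> + p \<beta> = \<beta>" by (simp only: add.commute)
      qed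
      have "card E1 = card E" unfolding E1_def
        by (intro card_image inj_on_inverseI[where g = "\<lambda>(a, b). a + b"]) (simp add: sum_eq)
      moreover have "card E2 = card E" unfolding E2_def
        by (intro card_image inj_on_inverseI[where g = "\<lambda>(a, b). a + b"]) (simp add: sum_eq)
      moreover have "E1 \<inter> E2 = {}"
      proof -
        have False if b: "\<beta> \<in> E" "\<beta>' \<in> E" "p \<beta> = q \<beta>'" "q \<beta> = p \<beta>'" for \<beta> \<beta>'
        proof -
          have "\<beta> = p \<beta> + q \<beta>" using sum_eq(1)[OF b(1)] by (rule sym)
          also have "\<dots> = \<beta>'" unfolding b(3,4) by (rule sum_eq(2)[OF b(2)])
          finally show False using b(3) ne[OF b(1)] by simp
        qed
        then show ?thesis by (auto simp: E1_def E2_def)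
      qed
      ultimately show ?thesis
        using finE by (subst card_Un_disjoint) (auto simp: E1_def E2_def)
    qed
    finally show ?thesis by simp
  qed
  finally show ?thesis by simp
qed

end

text \<open>
The dual point is at least \<open>1/2\<close> on the base and \<open>1\<close> on \<open>A\<close>, so an element of
\<open>A - J\<close> is the sum of two elements of \<open>J\<close>. These are not in \<open>A\<close>, so
\<open>A - J\<close> is a set of edges on the vertex set \<open>J - A\<close>. Since \<open>A\<close> and \<open>J\<close> have the same
size, there are as many edges as vertices, which is possible only if there are none.
\<close>

lemma (in root_antichain) spanning_antichain_eq_base:
  assumes J: "J \<subseteq> P" and ind: "independent J"
    and gen: "\<And>\<gamma>. \<gamma> \<in> P \<Longrightarrow> \<exists>xs. set xs \<subseteq> J \<and> sum_list xs = \<gamma>"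
    and spn: "P \<subseteq> span A"
  shows "A = J"
proof -
  interpret J: root_antichain \<Phi> P J using J ind gen by (rule base_is_antichain)
  obtain x where x: "\<forall>\<beta>\<in>A. x \<bullet> \<beta> = 1" using independent_ex_functional[OF independent_A] by auto
  have half: "1/2 \<le> x \<bullet> \<gamma>" if g: "\<gamma> \<in> P" for \<gamma>
  proof -
    obtain k where k: "2 * (x \<bullet> \<gamma>) = of_int k"
      using dual_point_pos_half_integral(1)[OF x spn g] by (auto elim!: Ints_cases)
    have "0 < (of_int k :: real)" using dual_point_pos_half_integral(2)[OF x spn g] k by linarith
    then have "1 \<le> k" by simp
    then have "1 \<le> 2 * (x \<bullet> \<gamma>)" unfolding k by simp
    then show ?thesis by simp
  qed
  have len: "length xs \<le> 2 * (x \<bullet> sum_list xs)" if "set xs \<subseteq> J" for xs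
    using that
  proof (induction xs)
    case (Cons a xs)
    then show ?case using half[of a] J by (auto simp: inner_add_right)
  qed simp
  have split: "\<exists>\<alpha>\<in>J - A. \<exists>\<alpha>'\<in>J - A. \<alpha> \<noteq> \<alpha>' \<and> \<beta> = \<alpha> + \<alpha>'" if b: "\<beta> \<in> A - J" for \<beta>
  proof -
    have bP: "\<beta> \<in> P" using b A_sub by auto
    obtain xs where xs: "set xs \<subseteq> J" "sum_list xs = \<beta>" using gen[OF bP] by auto
    have xsP: "set xs \<subseteq> P" using xs J by auto
    have "length xs \<le> 2" using len[OF xs(1)] xs(2) x b by simp
    moreover have "length xs \<noteq> 0" using xs bP P_sub zero_notin by auto
    moreover have "length xs \<noteq> 1" using xs b by (auto simp: length_Suc_conv)
    ultimately have "length xs = 2" by linarith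
    then obtain \<alpha> \<alpha>' where *: "xs = [\<alpha>, \<alpha>']" by (auto simp: length_Suc_conv numeral_2_eq_2)
    have "\<delta> \<notin> A" if "\<delta> \<in> set xs" for \<delta>
      using mem_summand_eq[of \<beta> xs \<delta>] b xs xsP that * by auto
    moreover have "\<alpha> \<noteq> \<alpha>'"
    proof
      assume "\<alpha> = \<alpha>'"
      then have "2 *\<^sub>R \<alpha> \<in> \<Phi>" "\<alpha> \<in> \<Phi>" using xs xsP * bP P_sub by (auto simp: scaleR_2)
      then show False using reduced[of \<alpha> 2] by simp
    qed
    ultimately show ?thesis using xs * by auto
  qed
  have "sum_list xs \<in> span J" if "set xs \<subseteq> J" for xs
    using that by (induction xs) (auto intro: span_add span_base span_zero)
  then have "P \<subseteq> span J" using gen by blast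
  then have "span A = span J"
    using A_sub J spn by (intro antisym span_minimal) (auto intro: subspace_span)
  then have card: "card A = card J"
    using dim_eq_card_independent[OF ind] dim_eq_card_independent[OF independent_A] by (metis dim_span)
  have "J - A = {}"
  proof (rule ccontr)
    assume "J - A \<noteq> {}"
    then have "card (A - J) < card (J - A)"
      using J.card_edges_less[of "J - A" "A - J"] split A_sub P_sub by blast
    moreover have "card A = card (A - J) + card (A \<inter> J)" "card J = card (J - A) + card (A \<inter> J)"
      using finite_A J.finite_A by (metis card_Int_Diff add.commute, metis card_Int_Diff add.commute Int_commute)
    ultimately show False using card by simp
  qed
  then have "J \<subseteq> A" by auto
  then show ?thesis using card card_subset_eq[OF finite_A, of J] by simp
qed

section \<open>Reduction to the spanning case\<close>

lemma (in root_set) weyl_group_isometry: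
  assumes "y \<in> weyl_group \<Phi>" shows "orthogonal_transformation y \<and> y ` \<Phi> = \<Phi>"
proof -
  have refl: "orthogonal_transformation (reflection \<alpha>) \<and> reflection \<alpha> ` \<Phi> = \<Phi>" if "\<alpha> \<in> \<Phi>" for \<alpha>
  proof
    show "orthogonal_transformation (reflection \<alpha>)"
      by (simp add: orthogonal_transformation_def linear_reflection reflection_inner_reflection)
    show "reflection \<alpha> ` \<Phi> = \<Phi>"
      using reflection_mem[OF that] by (force intro: image_eqI[of _ _ "reflection \<alpha> _"])
  qed
  have Bij: "f \<in> Bij UNIV" if "orthogonal_transformation f" for f :: "'a \<Rightarrow> 'a"
    using orthogonal_transformation_bij[OF that] by (simp add: Bij_def)
  show ?thesis using assms unfolding weyl_group_def
  proof (induction rule: generate.induct)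
    case one
    then show ?case by (simp add: BijGroup_def orthogonal_transformation_id[unfolded id_def])
  next
    case (incl h)
    then show ?case using refl by auto
  next
    case (inv h)
    then obtain \<alpha> where a: "\<alpha> \<in> \<Phi>" "h = reflection \<alpha>" by auto
    have "inv_into UNIV h = h"
      unfolding a by (rule ext) (metis inv_f_f inj_on_inverseI reflection_reflection)
    then have "inv\<^bsub>BijGroup UNIV\<^esub> h = h"
      using inv_BijGroup[OF Bij[of h]] refl a by (simp add: restrict_def)
    then show ?case using refl a by simp
  next
    case (eng h1 h2)
    have "h1 \<otimes>\<^bsub>BijGroup UNIV\<^esub> h2 = h1 \<circ> h2"
      using eng Bij by (simp add: BijGroup_def compose_def o_def restrict_def)
    then show ?case using eng
      by (metis image_comp orthogonal_transformation_compose)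
  qed
qed

lemma (in root_set) weyl_group_reflection_comp:
  assumes "y \<in> weyl_group \<Phi>" "\<alpha> \<in> \<Phi>" shows "reflection \<alpha> \<circ> y \<in> weyl_group \<Phi>"
proof -
  have r: "reflection \<alpha> \<in> weyl_group \<Phi>"
    unfolding weyl_group_def using assms(2) by (auto intro: generate.incl)
  then have "orthogonal_transformation (reflection \<alpha>)" "orthogonal_transformation y"
    using weyl_group_isometry assms by blast+
  then have "reflection \<alpha> \<in> Bij UNIV" "y \<in> Bij UNIV"
    by (simp_all add: Bij_def orthogonal_transformation_bij)
  then have "reflection \<alpha> \<otimes>\<^bsub>BijGroup UNIV\<^esub> y = reflection \<alpha> \<circ> y"
    by (simp add: BijGroup_def compose_def o_def restrict_def)
  then show ?thesis
    using generate.eng[of "reflection \<alpha>" "BijGroup UNIV" "reflection ` \<Phi>" y] r assms(1)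
    by (simp add: weyl_group_def)
qed

text \<open>
Choose \<open>y\<close> to maximise the inner product of \<open>y l\<close> with the sum of the positive coroots: if
\<open>y l\<close> were negative on a positive root, reflecting in that root would increase it. The maximum
exists because the value only depends on the set of roots that \<open>y\<close> makes positive, and there
are finitely many such sets.
\<close>

lemma (in positive_system) ex_weyl_dominant:
  "\<exists>y\<in>weyl_group \<Phi>. \<forall>\<alpha>\<in>P. 0 \<le> y l \<bullet> \<alpha>"
proof -
  let ?v = "coroot_sum P"
  define V where "V = (\<lambda>y. y l \<bullet> ?v) ` weyl_group \<Phi>"
  have "V \<subseteq> (\<lambda>Q. l \<bullet> coroot_sum Q) ` Pow \<Phi>"
  proof
    fix r assume "r \<in> V"
    then obtain y where y: "y \<in> weyl_group \<Phi>" "r = y l \<bullet> ?v" by (auto simp: V_def)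
    have o: "orthogonal_transformation y" "y ` \<Phi> = \<Phi>" using weyl_group_isometry[OF y(1)] by auto
    define Q where "Q = {\<gamma> \<in> \<Phi>. y \<gamma> \<in> P}"
    have yQ: "y ` Q = P" using o(2) P_sub by (auto simp: Q_def)
    have inj: "inj y" using o(1) by (rule orthogonal_transformation_inj)
    have "r = (\<Sum>\<delta>\<in>P. 2 * (\<delta> \<bullet> y l) / (\<delta> \<bullet> \<delta>))"
      using y(2) coroot_sum_inner[of P "y l"] by (simp add: inner_commute)
    also have "\<dots> = (\<Sum>\<delta>\<in>Q. 2 * (y \<delta> \<bullet> y l) / (y \<delta> \<bullet> y \<delta>))"
      unfolding yQ[symmetric] using inj by (subst sum.reindex) (auto intro: inj_on_subset)
    also have "\<dots> = l \<bullet> coroot_sum Q"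
      using o(1) coroot_sum_inner[of Q l] by (simp add: orthogonal_transformation_def inner_commute)
    finally show "r \<in> (\<lambda>Q. l \<bullet> coroot_sum Q) ` Pow \<Phi>" by (auto simp: Q_def)
  qed
  then have finV: "finite V" using finite_roots by (auto intro: finite_subset)
  have "(\<one>\<^bsub>BijGroup UNIV\<^esub>) \<in> weyl_group \<Phi>" unfolding weyl_group_def by (rule generate.one)
  then have "V \<noteq> {}" by (auto simp: V_def)
  then have "Max V \<in> V" using finV by simp
  then obtain y where y: "y \<in> weyl_group \<Phi>" "y l \<bullet> ?v = Max V" by (auto simp: V_def)
  have "0 \<le> y l \<bullet> \<alpha>" if a: "\<alpha> \<in> P" for \<alpha>
  proof -
    have aF: "\<alpha> \<in> \<Phi>" using a P_sub by auto
    have "reflection \<alpha> (y l) \<bullet> ?v \<in> V"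
      using weyl_group_reflection_comp[OF y(1) aF] unfolding V_def by (rule rev_image_eqI) simp
    then have "reflection \<alpha> (y l) \<bullet> ?v \<le> y l \<bullet> ?v" using finV y(2) by simp
    then have "0 \<le> 2 * (y l \<bullet> \<alpha>) / (\<alpha> \<bullet> \<alpha>) * (\<alpha> \<bullet> ?v)" by (simp add: reflection_inner)
    moreover have "0 < \<alpha> \<bullet> ?v" using positive_functional[OF a] by (simp add: inner_commute)
    ultimately have "0 \<le> 2 * (y l \<bullet> \<alpha>) / (\<alpha> \<bullet> \<alpha>)" using mult_neg_pos[of "2 * (y l \<bullet> \<alpha>) / (\<alpha> \<bullet> \<alpha>)" "\<alpha> \<bullet> ?v"] by linarith
    then show ?thesis using inner_self_pos[OF aF] by (simp add: zero_le_divide_iff)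
  qed
  then show ?thesis using y(1) by blast
qed

text \<open>
A subspace is not a finite union of proper subspaces. The vectors of \<open>F\<close> are treated one at a time: adding a
multiple of a vector not orthogonal to the new one has to avoid finitely many multiples.
\<close>

lemma ex_generic_orthogonal:
  fixes U :: "'a::euclidean_space set"
  assumes U: "subspace U" and fin: "finite F" and F: "F \<inter> U = {}"
  shows "\<exists>z. (\<forall>u\<in>U. z \<bullet> u = 0) \<and> (\<forall>\<gamma>\<in>F. z \<bullet> \<gamma> \<noteq> 0)"
  using fin F
proof (induction F rule: finite_induct)
  case empty
  show ?case by (intro exI[of _ 0]) auto
next
  case (insert \<gamma> F)
  then obtain z where z: "\<forall>u\<in>U. z \<bullet> u = 0" "\<forall>\<delta>\<in>F. z \<bullet> \<delta> \<noteq> 0" by auto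
  obtain u w where uw: "u \<in> span U" "\<And>x. x \<in> span U \<Longrightarrow> orthogonal w x" "\<gamma> = u + w"
    using orthogonal_subspace_decomp_exists[of U \<gamma>] by metis
  have "w \<noteq> 0" using uw(1,3) insert.prems U by (auto simp: span_eq_iff[THEN iffD2])
  moreover have "w \<bullet> \<gamma> = w \<bullet> w" using uw(2)[OF uw(1)] by (simp add: uw(3) inner_add_right orthogonal_def)
  ultimately have wg: "w \<bullet> \<gamma> \<noteq> 0" by simp
  have wU: "\<forall>u\<in>U. w \<bullet> u = 0" using uw(2) by (auto simp: orthogonal_def span_base)
  define bad where "bad = (\<lambda>\<delta>. - (z \<bullet> \<delta>) / (w \<bullet> \<delta>)) ` insert \<gamma> F"
  have "finite (insert 0 bad)" using insert.hyps by (simp add: bad_def)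
  then obtain t :: real where t: "t \<notin> insert 0 bad"
    using ex_new_if_finite[OF infinite_UNIV_char_0] by blast
  have "(z + t *\<^sub>R w) \<bullet> \<delta> \<noteq> 0" if "\<delta> \<in> insert \<gamma> F" for \<delta>
  proof (cases "w \<bullet> \<delta> = 0")
    case True
    then show ?thesis using that z(2) wg by (auto simp: inner_add_left)
  next
    case False
    have "t \<noteq> - (z \<bullet> \<delta>) / (w \<bullet> \<delta>)" using t that unfolding bad_def by blast
    then show ?thesis using False by (auto simp: inner_add_left field_simps eq_neg_iff_add_eq_0)
  qed
  then show ?case using z(1) wU by (intro exI[of _ "z + t *\<^sub>R w"]) (auto simp: inner_add_left)
qed

lemma (in positive_system) positive_system_Int_subspace:
  assumes U: "subspace U" shows "positive_system (\<Phi> \<inter> U) (P \<inter> U)"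
proof
  show "finite (\<Phi> \<inter> U)" "0 \<notin> \<Phi> \<inter> U" using finite_roots zero_notin by auto
  show "P \<inter> U \<subseteq> \<Phi> \<inter> U" using P_sub by auto
  fix \<alpha> assume a: "\<alpha> \<in> \<Phi> \<inter> U"
  show "c = 1 \<or> c = -1" if "c *\<^sub>R \<alpha> \<in> \<Phi> \<inter> U" for c using reduced that a by auto
  show "\<alpha> \<in> P \<inter> U \<or> - \<alpha> \<in> P \<inter> U" using P_total a subspace_neg[OF U] by auto
  fix \<beta> assume b: "\<beta> \<in> \<Phi> \<inter> U"
  show "reflection \<alpha> \<beta> \<in> \<Phi> \<inter> U"
    using reflection_mem a b U by (auto simp: reflection_def intro: subspace_diff subspace_scale)
  show "2 * (\<beta> \<bullet> \<alpha>) / (\<alpha> \<bullet> \<alpha>) \<in> \<int>" using cartan_Ints a b by auto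
next
  fix \<gamma> assume "\<gamma> \<in> P \<inter> U" then show "- \<gamma> \<notin> P \<inter> U" using P_anti by auto
next
  fix \<gamma> \<delta> assume "\<gamma> \<in> P \<inter> U" "\<delta> \<in> P \<inter> U" "\<gamma> + \<delta> \<in> \<Phi> \<inter> U"
  then show "\<gamma> + \<delta> \<in> P \<inter> U" using P_add by auto
qed

text \<open>
The roots in a subspace \<open>U\<close> are moved to the zero set of a dominant vector \<open>z\<close>, and their
positivity is preserved. One Weyl group element achieves both when it is chosen for a large
multiple of a generic vector orthogonal to \<open>U\<close> plus a regular dominant vector: outside
\<open>U\<close> the first summand decides the sign, and inside \<open>U\<close> only the second one is seen.
\<close>

lemma (in positive_system) ex_weyl_parabolic:
  assumes U: "subspace U"
  shows "\<exists>y z. y \<in> weyl_group \<Phi> \<and> y ` (P \<inter> U) \<subseteq> P \<and>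
     (\<forall>\<alpha>\<in>P. 0 \<le> z \<bullet> \<alpha>) \<and> (\<forall>\<alpha>\<in>\<Phi>. z \<bullet> \<alpha> = 0 \<longleftrightarrow> \<alpha> \<in> y ` U)"
proof -
  let ?v = "coroot_sum P"
  obtain z where z: "\<forall>u\<in>U. z \<bullet> u = 0" "\<forall>\<gamma>\<in>\<Phi> - U. z \<bullet> \<gamma> \<noteq> 0"
    using ex_generic_orthogonal[OF U, of "\<Phi> - U"] finite_roots by auto
  define N where "N = (\<Sum>\<gamma>\<in>\<Phi> - U. \<bar>?v \<bullet> \<gamma>\<bar> / \<bar>z \<bullet> \<gamma>\<bar>) + 1"
  define l where "l = ?v + N *\<^sub>R z"
  have big: "\<bar>?v \<bullet> \<gamma>\<bar> < N * \<bar>z \<bullet> \<gamma>\<bar>" if "\<gamma> \<in> \<Phi> - U" for \<gamma>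
  proof -
    have "\<bar>?v \<bullet> \<gamma>\<bar> / \<bar>z \<bullet> \<gamma>\<bar> < N"
      unfolding N_def using member_le_sum[OF that, of "\<lambda>\<gamma>. \<bar>?v \<bullet> \<gamma>\<bar> / \<bar>z \<bullet> \<gamma>\<bar>"] finite_roots by force
    then show ?thesis using z(2) that by (simp add: pos_divide_less_eq)
  qed
  have "N > 0" unfolding N_def by (rule add_nonneg_pos) (auto intro: sum_nonneg)
  obtain y where y: "y \<in> weyl_group \<Phi>" "\<forall>\<alpha>\<in>P. 0 \<le> y l \<bullet> \<alpha>" using ex_weyl_dominant by auto
  have o: "orthogonal_transformation y" "y ` \<Phi> = \<Phi>" using weyl_group_isometry[OF y(1)] by auto
  have iso: "y a \<bullet> y b = a \<bullet> b" for a b using o(1) by (simp add: orthogonal_transformation_def)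
  have inj: "inj y" using o(1) by (rule orthogonal_transformation_inj)
  have neg: "y (- a) = - y a" for a using o(1) by (simp add: orthogonal_transformation_def linear_neg)
  have "y \<gamma> \<in> P" if g: "\<gamma> \<in> P \<inter> U" for \<gamma>
  proof (rule ccontr)
    assume "y \<gamma> \<notin> P"
    moreover have "y \<gamma> \<in> \<Phi>" using g P_sub o(2) by auto
    ultimately have "y (- \<gamma>) \<in> P" using P_total neg by fastforce
    then have "0 \<le> l \<bullet> (- \<gamma>)" using y(2) iso by fastforce
    then have "?v \<bullet> \<gamma> \<le> 0" using z(1) g by (simp add: l_def inner_add_left)
    then show False using positive_functional[of \<gamma>] g by simp
  qed
  moreover have "0 \<le> y z \<bullet> \<alpha>" if a: "\<alpha> \<in> P" for \<alpha>
  proof -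
    obtain \<gamma> where g: "\<gamma> \<in> \<Phi>" "\<alpha> = y \<gamma>" using a P_sub o(2) by auto
    have "0 \<le> l \<bullet> \<gamma>" using y(2) a g iso by fastforce
    have "0 \<le> z \<bullet> \<gamma>"
    proof (cases "\<gamma> \<in> U")
      case True then show ?thesis using z by simp
    next
      case False
      show ?thesis
      proof (rule ccontr)
        assume n: "\<not> 0 \<le> z \<bullet> \<gamma>"
        then have "\<bar>?v \<bullet> \<gamma>\<bar> < - (N * (z \<bullet> \<gamma>))" using big[of \<gamma>] False g by simp
        then show False using \<open>0 \<le> l \<bullet> \<gamma>\<close> by (simp add: l_def inner_add_left)
      qed
    qed
    then show ?thesis using g iso by simp
  qed
  moreover have "y z \<bullet> \<alpha> = 0 \<longleftrightarrow> \<alpha> \<in> y ` U" if a: "\<alpha> \<in> \<Phi>" for \<alpha>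
  proof -
    obtain \<gamma> where g: "\<gamma> \<in> \<Phi>" "\<alpha> = y \<gamma>" using a o(2) by auto
    have "\<alpha> \<in> y ` U \<longleftrightarrow> \<gamma> \<in> U" using g inj by (simp add: inj_image_mem_iff)
    then show ?thesis using g iso z by auto
  qed
  ultimately show ?thesis using y(1) by (intro exI[of _ y] exI[of _ "y z"]) auto
qed

text \<open>
A positive root in \<open>y U\<close> is annihilated by the dominant vector \<open>z\<close>, so all simple roots
occurring in it are annihilated as well and lie in \<open>y U\<close>. Thus the simple roots in \<open>y U\<close> generate the positive
roots in \<open>y U\<close>, and the spanning case applies to \<open>y A\<close>.
\<close>

lemma (in root_antichain) antichain_conjugate_to_base_subset:
  assumes D: "\<Delta> \<subseteq> P" and ind: "independent \<Delta>"
    and gen: "\<And>\<gamma>. \<gamma> \<in> P \<Longrightarrow> \<exists>xs. set xs \<subseteq> \<Delta> \<and> sum_list xs = \<gamma>"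
  shows "\<exists>y\<in>weyl_group \<Phi>. y ` A \<subseteq> \<Delta>"
proof -
  define U where "U = span A"
  have U: "subspace U" by (simp add: U_def)
  obtain y z where y: "y \<in> weyl_group \<Phi>" "y ` (P \<inter> U) \<subseteq> P"
     and z: "\<forall>\<alpha>\<in>P. 0 \<le> z \<bullet> \<alpha>" "\<forall>\<alpha>\<in>\<Phi>. z \<bullet> \<alpha> = 0 \<longleftrightarrow> \<alpha> \<in> y ` U"
    using ex_weyl_parabolic[OF U] by blast
  have o: "orthogonal_transformation y" "y ` \<Phi> = \<Phi>" using weyl_group_isometry[OF y(1)] by auto
  have lin: "linear y" using o(1) by (simp add: orthogonal_transformation_def)
  have inj: "inj y" using o(1) by (rule orthogonal_transformation_inj)
  let ?U = "y ` U"
  let ?J = "\<Delta> \<inter> ?U"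
  interpret U: positive_system "\<Phi> \<inter> ?U" "P \<inter> ?U"
    using positive_system_Int_subspace linear_subspace_image[OF lin U] by blast
  have yP: "y \<gamma> \<in> P \<longleftrightarrow> \<gamma> \<in> P" if "\<gamma> \<in> \<Phi> \<inter> U" for \<gamma>
  proof
    assume "y \<gamma> \<in> P"
    then have "- \<gamma> \<notin> P" using y(2) that P_anti subspace_neg[OF U] linear_neg[OF lin, of \<gamma>] by fastforce
    then show "\<gamma> \<in> P" using P_total that by auto
  qed (use y(2) that in auto)
  have pull: "\<exists>ys. set ys \<subseteq> P \<and> y (sum_list ys) = sum_list xs" if "set xs \<subseteq> P \<inter> ?U" for xs
    using that
  proof (induction xs)
    case Nil
    then show ?case by (intro exI[of _ "[]"]) (simp add: linear_0[OF lin])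
  next
    case (Cons a xs)
    then obtain ys where ys: "set ys \<subseteq> P" "y (sum_list ys) = sum_list xs" by auto
    obtain \<gamma> where g: "\<gamma> \<in> U" "a = y \<gamma>" using Cons.prems by auto
    have "y \<gamma> \<in> y ` \<Phi>" using Cons.prems g(2) P_sub o(2) by auto
    then have "\<gamma> \<in> \<Phi>" using inj by (simp add: inj_image_mem_iff)
    then have "\<gamma> \<in> P" using yP[of \<gamma>] g Cons.prems by auto
    then show ?case using ys g by (intro exI[of _ "\<gamma> # ys"]) (simp add: linear_add[OF lin])
  qed
  interpret yA: root_antichain "\<Phi> \<inter> ?U" "P \<inter> ?U" "y ` A"
  proof
    have "A \<subseteq> P \<inter> U" using A_sub by (auto simp: U_def span_base)
    then show "y ` A \<subseteq> P \<inter> ?U" using y(2) by blast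
    fix \<alpha> \<beta> assume "\<alpha> \<in> y ` A" "\<beta> \<in> y ` A" and p: "root_prec (P \<inter> ?U) \<alpha> \<beta>"
    then obtain a b where ab: "a \<in> A" "b \<in> A" "\<alpha> = y a" "\<beta> = y b" by auto
    obtain xs where xs: "set xs \<subseteq> P \<inter> ?U" "\<beta> - \<alpha> = sum_list xs" using p by (auto simp: root_prec_def)
    obtain ys where ys: "set ys \<subseteq> P" "y (sum_list ys) = sum_list xs" using pull[OF xs(1)] by auto
    have "y (b - a) = y (sum_list ys)" using ab xs ys by (simp add: linear_diff[OF lin])
    then have "b - a = sum_list ys" using inj by (simp add: inj_eq)
    then have "root_prec P a b" using ys by (auto simp: root_prec_def)
    then show "\<alpha> = \<beta>" using A_anti ab by auto
  qed
  have "y ` A = ?J"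
  proof (rule yA.spanning_antichain_eq_base)
    show "?J \<subseteq> P \<inter> ?U" using D by auto
    show "independent ?J" using ind independent_mono by blast
    show "P \<inter> ?U \<subseteq> span (y ` A)" by (simp add: linear_span_image[OF lin] U_def)
    fix \<gamma> assume g: "\<gamma> \<in> P \<inter> ?U"
    then obtain xs where xs: "set xs \<subseteq> \<Delta>" "sum_list xs = \<gamma>" using gen by auto
    have "z \<bullet> sum_list xs = 0" using z(2) g xs P_sub by auto
    then have "\<forall>\<alpha>\<in>set xs. z \<bullet> \<alpha> = 0" using xs(1)
    proof (induction xs)
      case (Cons a xs)
      have "0 \<le> z \<bullet> a" using Cons.prems z(1) D by auto
      moreover have "0 \<le> z \<bullet> sum_list xs"
        using Cons.prems(2) z(1) D by (induction xs) (auto simp: inner_add_right)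
      ultimately show ?case using Cons by (auto simp: inner_add_right)
    qed simp
    then have "set xs \<subseteq> ?J" using xs(1) z(2) D P_sub by blast
    then show "\<exists>xs. set xs \<subseteq> ?J \<and> sum_list xs = \<gamma>" using xs by auto
  qed
  then show ?thesis using y(1) by blast
qed

section \<open>Minimal and maximal roots of ideals\<close>

lemma positive_roots_sum_list:
  assumes "finite \<Delta>"
  shows "\<exists>xs. set xs \<subseteq> \<Delta> \<and> sum_list xs = (\<Sum>\<alpha>\<in>\<Delta>. of_nat (c \<alpha>) *\<^sub>R (\<alpha> :: 'a::euclidean_space))"
  using assms
proof (induction \<Delta> rule: finite_induct)
  case empty
  then show ?case by (intro exI[of _ "[]"]) simp
next
  case (insert a F)
  then obtain xs where xs: "set xs \<subseteq> F" "sum_list xs = (\<Sum>\<alpha>\<in>F. of_nat (c \<alpha>) *\<^sub>R \<alpha>)" by auto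
  have "sum_list (replicate n a) = of_nat n *\<^sub>R a" for n
    by (induction n) (auto simp: algebra_simps)
  then show ?case using xs insert.hyps
    by (intro exI[of _ "replicate (c a) a @ xs"]) auto
qed

lemma positive_rootsI:
  "\<gamma> \<in> \<Phi> \<Longrightarrow> \<gamma> = (\<Sum>\<alpha>\<in>\<Delta>. of_nat (c \<alpha>) *\<^sub>R \<alpha>) \<Longrightarrow> \<gamma> \<in> positive_roots \<Phi> \<Delta>"
  unfolding positive_roots_def by (intro CollectI conjI exI[of _ c])

lemma root_base_positive_system:
  fixes \<Phi> \<Delta> :: "'a::euclidean_space set"
  assumes rs: "root_system \<Phi>" and base: "root_base \<Phi> \<Delta>"
  shows "positive_system \<Phi> (positive_roots \<Phi> \<Delta>)" and "\<Delta> \<subseteq> positive_roots \<Phi> \<Delta>"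
proof -
  have D: "\<Delta> \<subseteq> \<Phi>" "independent \<Delta>" using base by (auto simp: root_base_def)
  have finD: "finite \<Delta>" using D rs by (auto simp: root_system_def intro: finite_subset)
  let ?P = "positive_roots \<Phi> \<Delta>"
  show "\<Delta> \<subseteq> ?P"
  proof
    fix \<beta> assume b: "\<beta> \<in> \<Delta>"
    have "(\<Sum>\<alpha>\<in>\<Delta>. of_nat (if \<alpha> = \<beta> then 1 else 0) *\<^sub>R \<alpha>) =
        (\<Sum>\<alpha>\<in>\<Delta>. if \<alpha> = \<beta> then \<alpha> else 0)"
      by (rule sum.cong) simp_all
    also have "\<dots> = \<beta>" using b finD by simp
    finally have e: "\<beta> = (\<Sum>\<alpha>\<in>\<Delta>. of_nat (if \<alpha> = \<beta> then 1 else 0) *\<^sub>R \<alpha>)" by (rule sym)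
    have "\<beta> \<in> \<Phi>" using b D by auto
    then show "\<beta> \<in> ?P" using e by (rule positive_rootsI)
  qed
  interpret root_set \<Phi>
    using rs by unfold_locales (auto simp: root_system_def)
  show "positive_system \<Phi> ?P"
  proof
    show "?P \<subseteq> \<Phi>" by (auto simp: positive_roots_def)
  next
    fix \<gamma> assume g: "\<gamma> \<in> \<Phi>"
    then obtain c :: "'a \<Rightarrow> int" where c: "\<gamma> = (\<Sum>\<alpha>\<in>\<Delta>. of_int (c \<alpha>) *\<^sub>R \<alpha>)"
      "(\<forall>\<alpha>\<in>\<Delta>. c \<alpha> \<ge> 0) \<or> (\<forall>\<alpha>\<in>\<Delta>. c \<alpha> \<le> 0)"
      using base unfolding root_base_def by blast
    from c(2) show "\<gamma> \<in> ?P \<or> - \<gamma> \<in> ?P"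
    proof
      assume "\<forall>\<alpha>\<in>\<Delta>. c \<alpha> \<ge> 0"
      then have "\<gamma> = (\<Sum>\<alpha>\<in>\<Delta>. of_nat (nat (c \<alpha>)) *\<^sub>R \<alpha>)"
        unfolding c(1) by (intro sum.cong) simp_all
      from positive_rootsI[OF g this] show ?thesis ..
    next
      assume "\<forall>\<alpha>\<in>\<Delta>. c \<alpha> \<le> 0"
      then have "- \<gamma> = (\<Sum>\<alpha>\<in>\<Delta>. of_nat (nat (- c \<alpha>)) *\<^sub>R \<alpha>)"
        unfolding c(1) sum_negf[symmetric] by (intro sum.cong) simp_all
      from positive_rootsI[OF uminus_mem[OF g] this] show ?thesis ..
    qed
  next
    fix \<gamma> assume "\<gamma> \<in> ?P"
    then obtain c :: "'a \<Rightarrow> nat" where c: "\<gamma> \<in> \<Phi>" "\<gamma> = (\<Sum>\<alpha>\<in>\<Delta>. of_nat (c \<alpha>) *\<^sub>R \<alpha>)"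
      by (auto simp: positive_roots_def)
    show "- \<gamma> \<notin> ?P"
    proof
      assume "- \<gamma> \<in> ?P"
      then obtain d :: "'a \<Rightarrow> nat" where d: "- \<gamma> = (\<Sum>\<alpha>\<in>\<Delta>. of_nat (d \<alpha>) *\<^sub>R \<alpha>)"
        by (auto simp: positive_roots_def)
      have "(\<Sum>\<alpha>\<in>\<Delta>. real (c \<alpha> + d \<alpha>) *\<^sub>R \<alpha>) = \<gamma> + - \<gamma>"
        by (simp only: d) (simp add: c(2) scaleR_add_left sum.distrib)
      then have "\<forall>\<alpha>\<in>\<Delta>. real (c \<alpha> + d \<alpha>) = 0"
        using independentD[OF D(2) finD subset_refl, of "\<lambda>\<alpha>. real (c \<alpha> + d \<alpha>)"] by simp
      then have "\<forall>\<alpha>\<in>\<Delta>. c \<alpha> = 0" by (simp only: of_nat_eq_0_iff) simp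
      then have "\<gamma> = 0" unfolding c(2) by (intro sum.neutral) simp
      then show False using c(1) zero_notin by simp
    qed
  next
    fix \<gamma> \<delta> assume "\<gamma> \<in> ?P" "\<delta> \<in> ?P" and s: "\<gamma> + \<delta> \<in> \<Phi>"
    then obtain c d :: "'a \<Rightarrow> nat" where "\<gamma> = (\<Sum>\<alpha>\<in>\<Delta>. of_nat (c \<alpha>) *\<^sub>R \<alpha>)"
      "\<delta> = (\<Sum>\<alpha>\<in>\<Delta>. of_nat (d \<alpha>) *\<^sub>R \<alpha>)" by (auto simp: positive_roots_def)
    then have "\<gamma> + \<delta> = (\<Sum>\<alpha>\<in>\<Delta>. of_nat (c \<alpha> + d \<alpha>) *\<^sub>R \<alpha>)"
      by (simp add: scaleR_add_left sum.distrib)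
    then show "\<gamma> + \<delta> \<in> ?P" by (rule positive_rootsI[OF s])
  qed
qed

lemma antichain_conjugate_to_simple_roots:
  fixes \<Phi> \<Delta> A :: "'a::euclidean_space set"
  assumes rs: "root_system \<Phi>" and base: "root_base \<Phi> \<Delta>"
    and A: "A \<subseteq> positive_roots \<Phi> \<Delta>"
    and anti: "\<And>\<alpha> \<beta>. \<alpha> \<in> A \<Longrightarrow> \<beta> \<in> A \<Longrightarrow> root_prec (positive_roots \<Phi> \<Delta>) \<alpha> \<beta> \<Longrightarrow> \<alpha> = \<beta>"
  shows "\<exists>J y. J \<subseteq> \<Delta> \<and> y \<in> weyl_group \<Phi> \<and> y ` A = J"
proof -
  interpret positive_system \<Phi> "positive_roots \<Phi> \<Delta>"
    using root_base_positive_system[OF rs base] by simp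
  interpret root_antichain \<Phi> "positive_roots \<Phi> \<Delta>" A
    using A anti by unfold_locales
  have finD: "finite \<Delta>" using base finite_roots by (auto simp: root_base_def intro: finite_subset)
  have "\<exists>y\<in>weyl_group \<Phi>. y ` A \<subseteq> \<Delta>"
  proof (rule antichain_conjugate_to_base_subset)
    show "\<Delta> \<subseteq> positive_roots \<Phi> \<Delta>" using root_base_positive_system[OF rs base] by simp
    show "independent \<Delta>" using base by (simp add: root_base_def)
    show "\<exists>xs. set xs \<subseteq> \<Delta> \<and> sum_list xs = \<gamma>" if "\<gamma> \<in> positive_roots \<Phi> \<Delta>" for \<gamma>
      using that positive_roots_sum_list[OF finD] by (fastforce simp: positive_roots_def)
  qed
  then show ?thesis by blast
qed

theorem theorem6p4:
  fixes \<Phi> \<Delta> I :: "'a::euclidean_space set"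
  assumes "irreducible_root_system \<Phi>"
    and "root_base \<Phi> \<Delta>"
    and "root_ideal (positive_roots \<Phi> \<Delta>) I"
  shows "(\<exists>J y. J \<subseteq> \<Delta> \<and> y \<in> weyl_group \<Phi> \<and>
             y ` minimal_roots (positive_roots \<Phi> \<Delta>) I = J) \<and>
         (strictly_positive \<Delta> I \<longrightarrow>
           (\<exists>J y. J \<subseteq> \<Delta> \<and> y \<in> weyl_group \<Phi> \<and>
             y ` maximal_roots (positive_roots \<Phi> \<Delta>) (positive_roots \<Phi> \<Delta> - I) = J))"
proof (intro conjI impI)
  have rs: "root_system \<Phi>" using assms(1) by (simp add: irreducible_root_system_def)
  show "\<exists>J y. J \<subseteq> \<Delta> \<and> y \<in> weyl_group \<Phi> \<and>
      y ` minimal_roots (positive_roots \<Phi> \<Delta>) I = J"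
  proof (rule antichain_conjugate_to_simple_roots[OF rs assms(2)])
    show "minimal_roots (positive_roots \<Phi> \<Delta>) I \<subseteq> positive_roots \<Phi> \<Delta>"
      using assms(3) by (auto simp: minimal_roots_def root_ideal_def)
    fix \<alpha> \<beta>
    assume "\<alpha> \<in> minimal_roots (positive_roots \<Phi> \<Delta>) I"
      "\<beta> \<in> minimal_roots (positive_roots \<Phi> \<Delta>) I"
      and prec: "root_prec (positive_roots \<Phi> \<Delta>) \<alpha> \<beta>"
    then have "\<alpha> \<in> I" "\<forall>\<gamma>\<in>I. \<gamma> = \<beta> \<or> \<not> root_prec (positive_roots \<Phi> \<Delta>) \<gamma> \<beta>"
      unfolding minimal_roots_def by simp_all
    then show "\<alpha> = \<beta>" using prec by (elim ballE[of _ _ \<alpha>]) simp_all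
  qed
  show "\<exists>J y. J \<subseteq> \<Delta> \<and> y \<in> weyl_group \<Phi> \<and>
      y ` maximal_roots (positive_roots \<Phi> \<Delta>) (positive_roots \<Phi> \<Delta> - I) = J"
  proof (rule antichain_conjugate_to_simple_roots[OF rs assms(2)])
    show "maximal_roots (positive_roots \<Phi> \<Delta>) (positive_roots \<Phi> \<Delta> - I) \<subseteq> positive_roots \<Phi> \<Delta>"
      by (auto simp: maximal_roots_def)
    fix \<alpha> \<beta>
    assume "\<alpha> \<in> maximal_roots (positive_roots \<Phi> \<Delta>) (positive_roots \<Phi> \<Delta> - I)"
      "\<beta> \<in> maximal_roots (positive_roots \<Phi> \<Delta>) (positive_roots \<Phi> \<Delta> - I)"
      and prec: "root_prec (positive_roots \<Phi> \<Delta>) \<alpha> \<beta>"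
    then have "\<beta> \<in> positive_roots \<Phi> \<Delta> - I"
      "\<forall>\<gamma>\<in>positive_roots \<Phi> \<Delta> - I. \<gamma> = \<alpha> \<or> \<not> root_prec (positive_roots \<Phi> \<Delta>) \<alpha> \<gamma>"
      unfolding maximal_roots_def by simp_all
    then have "\<not> (\<beta> \<noteq> \<alpha>)" using prec by (elim ballE[of _ _ \<beta>]) simp_all
    then show "\<alpha> = \<beta>" by simp
  qed
qed

end
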